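(* For every $\lambda>0$ there is a constant $C_\lambda$ depending only on $\lambda$ such that for every $n\ge 1$ and all $p_1,\dots,p_n \in [0,1]$ with $p_1+\dots+p_n = \lambda$, setting $\lambda_2 = p_1^2+\dots+p_n^2$, $$H(Z) - H(W) \le C_\lambda\, \frac{\lambda_2}{\lambda}.$$ Moreover, if $\lambda_2 \le \frac12 \lambda$, one may take $C_\lambda = C\log(2+\lambda)$ with an absolute constant $C$; that is, there is an absolute constant $C$ such that $H(Z)-H(W) \le C\log(2+\lambda)\,\frac{\lambda_2}{\lambda}$ for all $\lambda>0$, all $n\ge 1$ and all $p_1,\dots,p_n\in[0,1]$ with $p_1+\dots+p_n=\lambda$ and $\lambda_2 = p_1^2+\dots+p_n^2 \le \frac12\lambda$.
   Context: $W = X_1+\dots+X_n$ is the sum of independent random variables $X_j$ taking the values $1$ and $0$ with probabilities $p_j$ and $1-p_j$. $Z$ is a Poisson random variable with parameter $\lambda$. With $w_k = \mathbb{P}\{W=k\}$ and $v_k = \mathbb{P}\{Z=k\}$, $H$ denotes the Shannon entropy: $H(Z) = -\sum_k v_k\log v_k$, $H(W) = -\sum_k w_k \log w_k$ (natural logarithm, $0\log 0=0$). *)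

theory Defs
  imports "HOL-Probability.Probability"
begin

text \<open>The convention \<open>0 * ln 0 = 0\<close> holds automatically. \<open>suminf\<close> is unspecified for
  divergent series; \<open>summable_entropy_bernoulli_sum\<close> and \<open>summable_entropy_poisson\<close>
  below show that the series converges for the laws of interest.\<close>

definition shannon_entropy :: "nat pmf \<Rightarrow> real" where
  "shannon_entropy q = - (\<Sum>k. pmf q k * ln (pmf q k))"

text \<open>The law of \<open>X\<^sub>1 + \<dots> + X\<^sub>n\<close> for independent \<open>X\<^sub>j\<close> with
  \<open>P(X\<^sub>j = 1) = p\<^sub>j\<close> and \<open>P(X\<^sub>j = 0) = 1 - p\<^sub>j\<close>; \<open>Pi_pmf\<close> is the product law. Working with
  laws keeps the constants of a theorem independent of the type of a sample space. The lemma
  \<open>prob_sum_eq_pmf_bernoulli_sum\<close> shows that every such sum, on any probability space,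
  has this law.\<close>

definition bernoulli_sum_pmf :: "nat \<Rightarrow> (nat \<Rightarrow> real) \<Rightarrow> nat pmf" where
  "bernoulli_sum_pmf n p =
     map_pmf (\<lambda>x. \<Sum>j=1..n. of_bool (x j)) (Pi_pmf {1..n} False (\<lambda>j. bernoulli_pmf (p j)))"

lemma bernoulli_sum_pmf_0: "bernoulli_sum_pmf 0 p = return_pmf 0"
  by (simp add: bernoulli_sum_pmf_def)

lemma bernoulli_sum_pmf_Suc:
  "bernoulli_sum_pmf (Suc n) p =
     bind_pmf (bernoulli_pmf (p (Suc n))) (\<lambda>b. map_pmf (\<lambda>w. of_bool b + w) (bernoulli_sum_pmf n p))"
proof -
  have ins: "{1..Suc n} = insert (Suc n) {1..n}" by auto
  have upd: "(\<Sum>j=1..Suc n. of_bool ((f(Suc n := b)) j)) =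
      of_bool b + (\<Sum>j=1..n. of_bool (f j) :: nat)" for f b
  proof -
    have "(\<Sum>j=1..n. of_bool ((f(Suc n := b)) j)) = (\<Sum>j=1..n. of_bool (f j) :: nat)"
      by (intro sum.cong) auto
    then show ?thesis unfolding ins by (subst sum.insert) auto
  qed
  have "Pi_pmf {1..Suc n} False (\<lambda>j. bernoulli_pmf (p j)) =
      bind_pmf (bernoulli_pmf (p (Suc n))) (\<lambda>b. bind_pmf
        (Pi_pmf {1..n} False (\<lambda>j. bernoulli_pmf (p j))) (\<lambda>f. return_pmf (f(Suc n := b))))"
    unfolding ins by (rule Pi_pmf_insert') auto
  then show ?thesis
    unfolding bernoulli_sum_pmf_def by (simp only: map_bind_pmf map_return_pmf upd)
      (simp only: map_pmf_def bind_assoc_pmf bind_return_pmf)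
qed

lemma pmf_bernoulli_sum_Suc:
  assumes "0 \<le> p (Suc n)" "p (Suc n) \<le> 1"
  shows "pmf (bernoulli_sum_pmf (Suc n) p) k =
    p (Suc n) * (if k = 0 then 0 else pmf (bernoulli_sum_pmf n p) (k - 1)) +
    (1 - p (Suc n)) * pmf (bernoulli_sum_pmf n p) k"
proof -
  have "pmf (map_pmf Suc q) k = (if k = 0 then 0 else pmf q (k - 1))" for q :: "nat pmf"
  proof (cases k)
    case 0
    then show ?thesis by (auto simp: pmf_eq_0_set_pmf)
  next
    case (Suc m)
    then show ?thesis using pmf_map_inj'[of Suc q m] by simp
  qed
  moreover have "(+) (0 :: nat) = (\<lambda>w. w)" "(+) (Suc 0) = Suc" by auto
  ultimately show ?thesis using assms
    by (simp add: bernoulli_sum_pmf_Suc pmf_bind map_pmf_ident mult.commute)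
qed

lemma (in prob_space) prob_sum_eq_pmf_bernoulli_sum:
  fixes X :: "nat \<Rightarrow> 'a \<Rightarrow> nat" and p :: "nat \<Rightarrow> real"
  assumes "indep_vars (\<lambda>_. count_space UNIV) X {1..n}"
    and "\<And>j. j \<in> {1..n} \<Longrightarrow> prob {\<omega> \<in> space M. X j \<omega> = 1} = p j"
    and "\<And>j. j \<in> {1..n} \<Longrightarrow> prob {\<omega> \<in> space M. X j \<omega> = 0} = 1 - p j"
  shows "prob {\<omega> \<in> space M. (\<Sum>j=1..n. X j \<omega>) = k} = pmf (bernoulli_sum_pmf n p) k"
  using assms
proof (induction n arbitrary: k)
  case 0
  show ?case
    by (cases "k = 0") (auto simp: bernoulli_sum_pmf_0 prob_space)
next
  case (Suc n)
  define m where "m = Suc n"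
  define S where "S \<omega> = (\<Sum>j=1..n. X j \<omega>)" for \<omega>
  have ins: "{1..Suc n} = insert m {1..n}" by (auto simp: m_def)
  have ind: "indep_vars (\<lambda>_. count_space UNIV) X (insert m {1..n})"
    using Suc.prems(1) by (simp only: ins)
  have rv [measurable]: "X j \<in> measurable M (count_space UNIV)" if "j \<in> insert m {1..n}" for j
    using ind that by (auto simp: indep_vars_def)
  have rvm [measurable]: "X m \<in> measurable M (count_space UNIV)" by (rule rv) simp
  have IH: "prob {\<omega> \<in> space M. S \<omega> = i} = pmf (bernoulli_sum_pmf n p) i" for i
    unfolding S_def
  proof (rule Suc.IH)
    show "indep_vars (\<lambda>_. count_space UNIV) X {1..n}"
      using ind by (rule indep_vars_subset) auto
  qed (use Suc.prems in auto)
  have rvS [measurable]: "S \<in> measurable M (count_space UNIV)"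
    unfolding S_def by (intro measurable_sum_nat rv) auto
  have pm: "prob {\<omega> \<in> space M. X m \<omega> = 1} = p m" "prob {\<omega> \<in> space M. X m \<omega> = 0} = 1 - p m"
    using Suc.prems(2,3)[of m] by (auto simp: m_def)
  have p01: "0 \<le> p m" "p m \<le> 1"
    using pm measure_nonneg[of M] prob_le_1 by (metis, metis)
  have joint: "prob {\<omega> \<in> space M. X m \<omega> = a \<and> S \<omega> = i} =
      prob {\<omega> \<in> space M. X m \<omega> = a} * prob {\<omega> \<in> space M. S \<omega> = i}" for a i
  proof -
    have "indep_var
      (count_space UNIV) ((\<lambda>f. f m) \<circ> (\<lambda>\<omega>. restrict (\<lambda>i. X i \<omega>) {m}))
      (count_space UNIV) ((\<lambda>f. \<Sum>j=1..n. f j) \<circ> (\<lambda>\<omega>. restrict (\<lambda>i. X i \<omega>) {1..n}))"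
      by (intro indep_var_compose[OF indep_var_restrict[OF ind]] measurable_sum_nat)
         (auto simp: m_def)
    also have "((\<lambda>f. f m) \<circ> (\<lambda>\<omega>. restrict (\<lambda>i. X i \<omega>) {m})) = X m" by auto
    also have "((\<lambda>f. \<Sum>j=1..n. f j) \<circ> (\<lambda>\<omega>. restrict (\<lambda>i. X i \<omega>) {1..n})) = S"
      by (auto simp: S_def fun_eq_iff intro!: sum.cong)
    finally have "indep_var (count_space UNIV) (X m) (count_space UNIV) S" .
    from indep_varD[OF this, of "{a}" "{i}"] show ?thesis
      by (simp add: vimage_def Int_def conj_commute conj_left_commute)
  qed
  have "prob {\<omega> \<in> space M. X m \<omega> = 0 \<or> X m \<omega> = 1} =
      prob {\<omega> \<in> space M. X m \<omega> = 0} + prob {\<omega> \<in> space M. X m \<omega> = 1}"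
    by (subst finite_measure_Union[symmetric]) (auto intro!: arg_cong[where f = prob])
  then have "prob {\<omega> \<in> space M. X m \<omega> = 0 \<or> X m \<omega> = 1} = 1" using pm by simp
  then have ae: "AE \<omega> in M. X m \<omega> = 0 \<or> X m \<omega> = 1"
    by (subst (asm) prob_Collect_eq_1) auto
  have tot: "(\<Sum>j=1..Suc n. X j \<omega>) = X m \<omega> + S \<omega>" for \<omega>
    by (simp add: S_def m_def)
  have "prob {\<omega> \<in> space M. X m \<omega> + S \<omega> = k} =
      prob ({\<omega> \<in> space M. X m \<omega> = 0 \<and> S \<omega> = k} \<union> {\<omega> \<in> space M. X m \<omega> = 1 \<and> Suc (S \<omega>) = k})"
    using ae by (intro finite_measure_eq_AE) auto
  also have "\<dots> = prob {\<omega> \<in> space M. X m \<omega> = 0 \<and> S \<omega> = k} +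
      prob {\<omega> \<in> space M. X m \<omega> = 1 \<and> Suc (S \<omega>) = k}"
    by (intro finite_measure_Union) auto
  also have "prob {\<omega> \<in> space M. X m \<omega> = 1 \<and> Suc (S \<omega>) = k} =
      (if k = 0 then 0 else prob {\<omega> \<in> space M. X m \<omega> = 1 \<and> S \<omega> = k - 1})"
    by (cases k) auto
  finally have "prob {\<omega> \<in> space M. X m \<omega> + S \<omega> = k} = (1 - p m) * pmf (bernoulli_sum_pmf n p) k +
      (if k = 0 then 0 else p m * pmf (bernoulli_sum_pmf n p) (k - 1))"
    unfolding joint IH pm .
  then show ?case
    using p01 unfolding tot by (simp add: pmf_bernoulli_sum_Suc m_def)
qed

lemma summable_entropy_bernoulli_sum:
  "summable (\<lambda>k. pmf (bernoulli_sum_pmf n p) k * ln (pmf (bernoulli_sum_pmf n p) k))"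
proof -
  have "set_pmf (bernoulli_sum_pmf n p) \<subseteq> {..n}"
  proof -
    have "(\<Sum>j=1..n. of_bool (x j) :: nat) \<le> n" for x :: "nat \<Rightarrow> bool"
      using sum_mono[of "{1..n}" "\<lambda>j. of_bool (x j) :: nat" "\<lambda>_. 1"] by simp
    then show ?thesis by (auto simp: bernoulli_sum_pmf_def)
  qed
  then show ?thesis
    by (intro summable_finite[of "{..n}"]) (auto simp: set_pmf_iff subset_iff)
qed

lemma summable_entropy_poisson:
  assumes "0 < lam"
  shows "summable (\<lambda>k. pmf (poisson_pmf lam) k * ln (pmf (poisson_pmf lam) k))"
proof (rule summable_comparison_test')
  show "summable (\<lambda>k. (\<bar>ln lam\<bar> + 1 + lam) * ((4 * lam) ^ k / fact k))"
    using summable_exp[of "4 * lam"] by (intro summable_mult) (simp add: field_simps)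
next
  fix k :: nat
  let ?v = "pmf (poisson_pmf lam) k"
  have v: "?v = lam ^ k / fact k * exp (- lam)" using assms by simp
  have lnv: "ln ?v = real k * ln lam - ln (fact k) - lam"
    unfolding v using assms by (simp add: ln_mult ln_div ln_realpow)
  have f: "0 \<le> ln (fact k :: real)" "ln (fact k :: real) \<le> real k * real k"
  proof -
    show "0 \<le> ln (fact k :: real)" by (simp add: fact_ge_1)
    have "ln (fact k :: real) \<le> ln (real k ^ k)"
      using fact_le_power[of k, where 'a = real] by (subst ln_le_cancel_iff) (auto intro: gr0I)
    also have "\<dots> \<le> real k * real k"
      by (cases "k = 0") (auto simp: ln_realpow intro!: mult_left_mono ln_bound)
    finally show "ln (fact k :: real) \<le> real k * real k" .
  qed
  have k2: "real k \<le> 2 ^ k" using of_nat_mono[OF less_imp_le[OF less_exp[of k]], where 'a = real] by simp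
  have k4: "real k * real k \<le> 4 ^ k"
    using mult_mono[OF k2 k2] by (simp add: power_mult_distrib[symmetric])
  have k4': "real k \<le> 4 ^ k"
    using k2 power_mono[of 2 "4::real" k] by simp
  have "\<bar>real k * ln lam\<bar> \<le> 4 ^ k * \<bar>ln lam\<bar>"
    unfolding abs_mult using k4' by (intro mult_right_mono) auto
  moreover have "lam \<le> 4 ^ k * lam" using assms by simp
  ultimately have "\<bar>ln ?v\<bar> \<le> 4 ^ k * (\<bar>ln lam\<bar> + 1 + lam)"
    unfolding lnv distrib_left mult_1_right using f k4 assms by linarith
  moreover have "0 \<le> ?v" "?v \<le> lam ^ k / fact k"
    unfolding v using assms by (auto intro!: divide_right_mono mult_left_le)
  ultimately have "\<bar>?v\<bar> * \<bar>ln ?v\<bar> \<le> lam ^ k / fact k * (4 ^ k * (\<bar>ln lam\<bar> + 1 + lam))"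
    using assms by (intro mult_mono) auto
  then show "norm (?v * ln ?v) \<le> (\<bar>ln lam\<bar> + 1 + lam) * ((4 * lam) ^ k / fact k)"
    by (simp add: abs_mult power_mult_distrib mult_ac)
qed

end

theory Submission
  imports Defs "HOL-Computational_Algebra.Polynomial" "HOL-Real_Asymp.Real_Asymp"
begin

text \<open>Since \<open>E W = E Z = \<lambda>\<close>, the gap \<open>H(Z) - H(W)\<close> is the sum of the relative entropy
  \<open>D(W||Z)\<close> and of \<open>E ln Z! - E ln W!\<close>. The second term is at most \<open>\<lambda>\<^sub>2 / \<lambda>\<close>: replace the
  Bernoulli variables by Poisson variables one at a time and use \<open>E 1/(S + 1) \<le> 1/E S\<close>. For the
  first term, replace \<open>p\<^sub>j\<close> by \<open>t p\<^sub>j\<close> and call the sum \<open>W\<^sub>t\<close>. Then \<open>d/dt D(W\<^sub>t||Po(t\<lambda>))\<close> is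
  \<open>\<lambda>\<close> times the relative entropy of the size-biased law of \<open>W\<^sub>t\<close>, shifted by one, with respect to
  \<open>W\<^sub>t\<close>. Bounding it by the chi-square distance gives \<open>D(W||Z) \<le> \<lambda>\<^sup>-\<^sup>1 \<Sigma> p\<^sub>j\<^sup>3 / (1 - p\<^sub>j)\<close>.
  Probabilities \<open>p\<^sub>j > 3/4\<close> are removed first: this decreases \<open>H(W)\<close>, and if
  \<open>\<lambda>\<^sub>2 \<le> \<lambda>/2\<close> it changes \<open>H(Z)\<close> by \<open>O(\<lambda>\<^sub>2 / \<lambda>)\<close>. If \<open>\<lambda>\<^sub>2 > \<lambda>/2\<close>, then \<open>H(W) \<ge> 0\<close> suffices.\<close>

subsection \<open>Sums of independent Bernoulli variables\<close>

text \<open>For \<open>q j\<close> in the unit interval this is the probability generating function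
  of the sum over \<open>I\<close>. An arbitrary finite index set allows variables to be split off
  or dropped factor by factor.\<close>

definition bernoulli_poly :: "('a \<Rightarrow> real) \<Rightarrow> 'a set \<Rightarrow> real poly" where
  "bernoulli_poly q I = (\<Prod>j\<in>I. [:1 - q j, q j:])"

lemma bernoulli_poly_empty [simp]: "bernoulli_poly q {} = 1"
  by (simp add: bernoulli_poly_def)

lemma coeff_bernoulli_factor:
  "coeff ([:1 - a, a:] * Q) k = (1 - a) * coeff Q k + a * (if k = 0 then 0 else coeff Q (k - 1))"
  for a :: real
  by (cases k) (auto simp: mult_pCons_left coeff_pCons)

lemma coeff_bernoulli_poly_insert:
  assumes "finite I" "j \<notin> I"
  shows "coeff (bernoulli_poly q (insert j I)) k = (1 - q j) * coeff (bernoulli_poly q I) k +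
    q j * (if k = 0 then 0 else coeff (bernoulli_poly q I) (k - 1))"
  using assms by (simp add: bernoulli_poly_def coeff_bernoulli_factor del: mult_pCons_left)

lemma coeff_bernoulli_poly_eq_0:
  assumes "finite I" "card I < k"
  shows "coeff (bernoulli_poly q I) k = 0"
  using assms
proof (induction I arbitrary: k)
  case empty
  then show ?case by (simp add: coeff_1)
qed (auto simp: coeff_bernoulli_poly_insert)

lemma coeff_bernoulli_poly_nonneg:
  assumes "finite I" "\<And>j. j \<in> I \<Longrightarrow> 0 \<le> q j \<and> q j \<le> 1"
  shows "0 \<le> coeff (bernoulli_poly q I) k"
  using assms
proof (induction I arbitrary: k)
  case empty
  then show ?case by (simp add: coeff_1)
qed (auto simp: coeff_bernoulli_poly_insert)

text \<open>Logarithms of these coefficients and quotients by them occur below. An index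
  \<open>k\<close> is either reachable without the variable \<open>j\<close>, or it is the new top
  index and is reached with \<open>X_j = 1\<close>.\<close>

lemma coeff_bernoulli_poly_pos:
  assumes "finite I" "\<And>j. j \<in> I \<Longrightarrow> 0 < q j \<and> q j < 1" "k \<le> card I"
  shows "0 < coeff (bernoulli_poly q I) k"
  using assms
proof (induction I arbitrary: k)
  case (insert j I)
  have q: "0 < q j" "q j < 1" using insert.prems by auto
  have nn: "0 \<le> coeff (bernoulli_poly q I) i" for i
    using insert.prems insert.hyps by (intro coeff_bernoulli_poly_nonneg) (auto intro: less_imp_le)
  show ?case
  proof (cases "k \<le> card I")
    case True
    then have "0 < coeff (bernoulli_poly q I) k" using insert by auto
    then show ?thesis
      unfolding coeff_bernoulli_poly_insert[OF insert.hyps]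
      using q nn[of "k-1"] by (intro add_pos_nonneg) auto
  next
    case False
    then have "0 < coeff (bernoulli_poly q I) (k - 1)" "k \<noteq> 0"
      using insert by auto
    then show ?thesis
      unfolding coeff_bernoulli_poly_insert[OF insert.hyps]
      using q nn[of k] by (intro add_nonneg_pos) auto
  qed
qed auto

text \<open>The shift loses only the top term of the truncated sum, so a vanishing top term makes
  truncation harmless.\<close>

lemma sum_shift_down:
  fixes g :: "nat \<Rightarrow> real"
  assumes "g N = 0"
  shows "(\<Sum>k\<le>N. if k = 0 then 0 else g (k - 1)) = (\<Sum>k\<le>N. g k)"
proof (cases N)
  case (Suc M)
  have "(\<Sum>k\<le>Suc M. if k = 0 then 0 else g (k - 1)) = (\<Sum>k\<le>M. g k)"
    by (subst sum.atMost_Suc_shift) simp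
  then show ?thesis using assms Suc by simp
qed (use assms in auto)

lemma sum_coeff_bernoulli_poly:
  assumes "finite I" "card I \<le> N"
  shows "(\<Sum>k\<le>N. coeff (bernoulli_poly q I) k) = 1"
  using assms
proof (induction I)
  case empty
  have "(\<Sum>k\<le>N. coeff (1 :: real poly) k) = (\<Sum>k\<in>{0}. coeff (1 :: real poly) k)"
    by (rule sum.mono_neutral_right) (auto simp: coeff_1)
  then show ?case by (simp add: coeff_1)
next
  case (insert j I)
  have "coeff (bernoulli_poly q I) N = 0"
    using insert by (intro coeff_bernoulli_poly_eq_0) auto
  note s = sum_shift_down[where g = "coeff (bernoulli_poly q I)", OF this]
  show ?case
    using insert s
    by (simp add: coeff_bernoulli_poly_insert sum.distrib sum_distrib_left[symmetric])
qed

text \<open>The coefficients of the derivative, \<open>(k + 1) w\<^sub>k\<^sub>+\<^sub>1\<close>, are the unnormalised size-biased law.\<close>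

lemma coeff_pderiv_bernoulli_poly_insert:
  assumes "finite I" "j \<notin> I"
  shows "coeff (pderiv (bernoulli_poly q (insert j I))) k =
    q j * coeff (bernoulli_poly q I) k + (1 - q j) * coeff (pderiv (bernoulli_poly q I)) k +
    q j * (if k = 0 then 0 else coeff (pderiv (bernoulli_poly q I)) (k - 1))"
  using assms
  by (cases k) (auto simp: coeff_pderiv coeff_bernoulli_poly_insert algebra_simps)

text \<open>The left side is the derivative of the generating function at 1, hence the mean.\<close>

lemma sum_coeff_pderiv_bernoulli_poly:
  assumes "finite I" "card I \<le> N"
  shows "(\<Sum>k\<le>N. coeff (pderiv (bernoulli_poly q I)) k) = (\<Sum>j\<in>I. q j)"
  using assms
proof (induction I)
  case (insert j I)
  have "coeff (pderiv (bernoulli_poly q I)) N = 0"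
    using insert by (simp add: coeff_pderiv coeff_bernoulli_poly_eq_0)
  note s = sum_shift_down[where g = "coeff (pderiv (bernoulli_poly q I))", OF this]
  show ?case
    using insert s sum_coeff_bernoulli_poly[of I N q]
    by (simp add: coeff_pderiv_bernoulli_poly_insert sum.distrib sum_distrib_left[symmetric])
      (simp add: algebra_simps)
qed (simp add: coeff_pderiv)

section \<open>Second moment of the size-biased density\<close>

text \<open>This is the Cauchy--Schwarz inequality for two fractions. As division by zero yields 0,
  a vanishing denominator must come with a vanishing numerator.\<close>

lemma square_add_divide_le:
  fixes x y u v :: real
  assumes "0 \<le> u" "0 \<le> v" "u = 0 \<Longrightarrow> x = 0" "v = 0 \<Longrightarrow> y = 0"
  shows "(x + y)\<^sup>2 / (u + v) \<le> x\<^sup>2 / u + y\<^sup>2 / v"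
proof (cases "u = 0 \<or> v = 0")
  case False
  then have p: "0 < u" "0 < v" using assms by auto
  have "(x\<^sup>2 / u + y\<^sup>2 / v) - (x + y)\<^sup>2 / (u + v) = (x * v - y * u)\<^sup>2 / (u * v * (u + v))"
    using p by (simp add: divide_simps) (simp add: algebra_simps power2_eq_square)
  moreover have "\<dots> \<ge> 0" using p by simp
  ultimately show ?thesis by linarith
qed (use assms in auto)

text \<open>The quantity bounded here is \<open>E (E (\<Sigma> Y\<^sub>j | W))\<^sup>2\<close> with
  \<open>Y\<^sub>j = 1{X\<^sub>j = 0} q\<^sub>j / (1 - q\<^sub>j)\<close>; conditioning is a contraction, which one
  application of the Cauchy--Schwarz inequality per variable makes explicit.\<close>

lemma sum_size_bias_square_le:
  assumes "finite I" "\<And>j. j \<in> I \<Longrightarrow> 0 < q j \<and> q j < 1" "card I \<le> N"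
  shows "(\<Sum>k\<le>N. (coeff (pderiv (bernoulli_poly q I)) k)\<^sup>2 / coeff (bernoulli_poly q I) k)
    \<le> (\<Sum>j\<in>I. q j)\<^sup>2 + (\<Sum>j\<in>I. (q j) ^ 3 / (1 - q j))"
  using assms
proof (induction I)
  case (insert j I)
  define w where "w = coeff (bernoulli_poly q I)"
  define a where "a = coeff (pderiv (bernoulli_poly q I))"
  have q: "0 < q j" "q j < 1" using insert.prems by auto
  have w0: "0 \<le> w k" for k
    unfolding w_def using insert by (intro coeff_bernoulli_poly_nonneg) (auto intro: less_imp_le)
  have aw: "a k = 0" if "w k = 0" for k
  proof -
    have "card I < k"
      using that insert coeff_bernoulli_poly_pos[of I q k] unfolding w_def by (force simp: not_less)
    then show ?thesis using insert by (simp add: a_def coeff_pderiv coeff_bernoulli_poly_eq_0)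
  qed
  have wN: "w N = 0" using insert by (auto simp: w_def coeff_bernoulli_poly_eq_0)
  have sw: "(\<Sum>k\<le>N. w k) = 1" using insert unfolding w_def by (intro sum_coeff_bernoulli_poly) auto
  have sa: "(\<Sum>k\<le>N. a k) = (\<Sum>i\<in>I. q i)"
    using insert unfolding a_def by (intro sum_coeff_pderiv_bernoulli_poly) auto
  have step: "(coeff (pderiv (bernoulli_poly q (insert j I))) k)\<^sup>2 / coeff (bernoulli_poly q (insert j I)) k
      \<le> (1 - q j) * ((a k)\<^sup>2 / w k) + 2 * q j * a k + (q j)\<^sup>2 / (1 - q j) * w k
        + q j * (if k = 0 then 0 else (a (k - 1))\<^sup>2 / w (k - 1))" for k
  proof -
    \<comment> \<open>The pair \<open>?x\<close>, \<open>?u\<close> belongs to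
      \<open>X_j = 0\<close> and the pair \<open>?y\<close>, \<open>?v\<close> to
      \<open>X_j = 1\<close>. The extra term \<open>q j * w k\<close> joins the first pair because
      \<open>Y_j\<close> lives on \<open>X_j = 0\<close>.\<close>
    let ?x = "q j * w k + (1 - q j) * a k" and ?y = "q j * (if k = 0 then 0 else a (k - 1))"
    let ?u = "(1 - q j) * w k" and ?v = "q j * (if k = 0 then 0 else w (k - 1))"
    have "(coeff (pderiv (bernoulli_poly q (insert j I))) k)\<^sup>2 / coeff (bernoulli_poly q (insert j I)) k
       = (?x + ?y)\<^sup>2 / (?u + ?v)"
      using insert.hyps by (simp add: coeff_bernoulli_poly_insert coeff_pderiv_bernoulli_poly_insert a_def w_def)
    also have "\<dots> \<le> ?x\<^sup>2 / ?u + ?y\<^sup>2 / ?v"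
      by (rule square_add_divide_le) (use q w0 aw in \<open>auto split: if_splits\<close>)
    also have "?x\<^sup>2 / ?u = (1 - q j) * ((a k)\<^sup>2 / w k) + 2 * q j * a k + (q j)\<^sup>2 / (1 - q j) * w k"
    proof (cases "w k = 0")
      case False
      then show ?thesis using q
        by (simp add: divide_simps) (simp add: algebra_simps power2_eq_square)
    qed (use aw in simp)
    also have "?y\<^sup>2 / ?v = q j * (if k = 0 then 0 else (a (k - 1))\<^sup>2 / w (k - 1))"
      using q by (simp add: power2_eq_square)
    finally show ?thesis .
  qed
  have "(\<Sum>k\<le>N. (coeff (pderiv (bernoulli_poly q (insert j I))) k)\<^sup>2 / coeff (bernoulli_poly q (insert j I)) k)
      \<le> (\<Sum>k\<le>N. (1 - q j) * ((a k)\<^sup>2 / w k) + 2 * q j * a k + (q j)\<^sup>2 / (1 - q j) * w k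
        + q j * (if k = 0 then 0 else (a (k - 1))\<^sup>2 / w (k - 1)))"
    by (intro sum_mono step)
  \<comment> \<open>After the shift the weights \<open>1 - q j\<close> and \<open>q j\<close> of the
    quotients add up to 1. The top quotient vanishes since \<open>w N = 0\<close>.\<close>
  also have "\<dots> = (\<Sum>k\<le>N. (a k)\<^sup>2 / w k) + 2 * q j * (\<Sum>i\<in>I. q i) + (q j)\<^sup>2 / (1 - q j)"
    using sum_shift_down[of "\<lambda>k. (a k)\<^sup>2 / w k" N] wN
    by (simp only: sum.distrib sum_distrib_left[symmetric] sa sw) (simp add: algebra_simps)
  also have "\<dots> \<le> (\<Sum>i\<in>I. q i)\<^sup>2 + (\<Sum>i\<in>I. (q i) ^ 3 / (1 - q i)) + 2 * q j * (\<Sum>i\<in>I. q i)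
      + (q j)\<^sup>2 / (1 - q j)"
    using insert unfolding a_def w_def by auto
  \<comment> \<open>The part \<open>(q j)\<^sup>2\<close> completes the square of the new mean; the
    cubic part is the new error term.\<close>
  also have "(q j)\<^sup>2 / (1 - q j) = (q j)\<^sup>2 + (q j) ^ 3 / (1 - q j)"
    using q by (simp add: divide_simps) (simp add: algebra_simps power2_eq_square power3_eq_cube)
  finally show ?case
    using insert.hyps by (simp add: power2_sum algebra_simps)
qed simp

section \<open>Relative entropy along the scaling \<open>t * p j\<close>\<close>

text \<open>The generating function \<open>P\<close> is the product of the factors
  \<open>1 + t * p j * (z - 1)\<close>, so \<open>t\<close> times its derivative in \<open>t\<close>
  equals \<open>(z - 1)\<close> times its derivative in \<open>z\<close>. Compare coefficients of
  \<open>z^k\<close>.\<close>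

lemma has_real_derivative_coeff_bernoulli_poly:
  assumes "finite I" "t \<noteq> 0"
  shows "((\<lambda>t. coeff (bernoulli_poly (\<lambda>j. t * p j) I) k) has_real_derivative
     (real k * coeff (bernoulli_poly (\<lambda>j. t * p j) I) k - coeff (pderiv (bernoulli_poly (\<lambda>j. t * p j) I)) k) / t) (at t)"
  using assms(1)
proof (induction I arbitrary: k)
  case empty
  then show ?case by (cases "k = 0") (simp_all add: coeff_1 pderiv_1)
next
  case (insert j I)
  note [derivative_intros] = insert.IH
  show ?case
  proof (cases k)
    case 0
    show ?thesis unfolding 0 coeff_bernoulli_poly_insert[OF insert.hyps] coeff_pderiv
      using \<open>t \<noteq> 0\<close>
      by (auto intro!: derivative_eq_intros simp: coeff_pderiv field_simps)
  next
    case (Suc m)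
    show ?thesis unfolding Suc coeff_bernoulli_poly_insert[OF insert.hyps] coeff_pderiv
      using \<open>t \<noteq> 0\<close>
      by (auto intro!: derivative_eq_intros simp: coeff_pderiv field_simps)
  qed
qed

lemma continuous_on_coeff_bernoulli_poly:
  assumes "finite I"
  shows "continuous_on A (\<lambda>t. coeff (bernoulli_poly (\<lambda>j. t * p j) I) k)"
  using assms
proof (induction I arbitrary: k)
  case (insert j I)
  note [continuous_intros] = insert.IH
  show ?case unfolding coeff_bernoulli_poly_insert[OF insert.hyps]
    by (cases k) (auto intro!: continuous_intros)
qed auto

text \<open>The point 0 matters: all coefficients but the zeroth vanish at the start
  \<open>t = 0\<close> of the interpolation.\<close>

lemma continuous_on_x_ln_x: "continuous_on {0..} (\<lambda>x::real. x * ln x)"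
proof (unfold continuous_on_def, intro ballI)
  fix x :: real assume "x \<in> {0..}"
  show "((\<lambda>x. x * ln x) \<longlongrightarrow> x * ln x) (at x within {0..})"
  proof (cases "x = 0")
    case True
    have "((\<lambda>x::real. x * ln x) \<longlongrightarrow> 0) (at_right 0)" by real_asymp
    moreover have "at 0 within {0..} = at_right (0::real)"
      using at_within_Ici_at_right by blast
    ultimately show ?thesis using True by simp
  next
    case False
    then show ?thesis by (auto intro!: tendsto_intros)
  qed
qed

text \<open>The left side is the relative entropy of the Bernoulli sum with respect to the Poisson
  law of rate \<open>lam\<close>, with the mean \<open>lam\<close> already inserted. The mean value
  theorem along the scaling reduces the claim to a uniform bound on the derivative.\<close>

lemma entropy_deficit_bernoulli_poly_le:
  assumes I: "finite I" "I \<noteq> {}" and p: "\<And>j. j \<in> I \<Longrightarrow> 0 < p j \<and> p j < 1"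
    and lam: "lam = (\<Sum>j\<in>I. p j)"
  defines "w \<equiv> coeff (bernoulli_poly p I)"
  shows "(\<Sum>k\<le>card I. w k * ln (w k)) + (\<Sum>k\<le>card I. w k * ln (fact k)) + lam - lam * ln lam
    \<le> (\<Sum>j\<in>I. (p j) ^ 3 / (1 - p j)) / lam"
proof -
  define N where "N = card I"
  define P where "P t = bernoulli_poly (\<lambda>j. t * p j) I" for t
  define u where "u t = coeff (P t)" for t
  define a where "a t = coeff (pderiv (P t))" for t
  define c where "c = (\<Sum>j\<in>I. (p j) ^ 3 / (1 - p j))"
  define D where "D t = (\<Sum>k\<le>N. u t k * ln (u t k)) + (\<Sum>k\<le>N. u t k * ln (fact k)) + t * lam
    - t * lam * ln (t * lam)" for t
  have lam0: "0 < lam" unfolding lam using I p by (intro sum_pos) auto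
  have tp: "0 < t * p j \<and> t * p j < 1" if "0 < t" "t \<le> 1" "j \<in> I" for t j
    using p[OF that(3)] that(1,2) mult_left_le_one_le[of "p j" t] mult_pos_pos[of t "p j"] by linarith
  have c0: "0 \<le> c" unfolding c_def using p by (intro sum_nonneg) (auto intro!: divide_nonneg_pos simp: less_imp_le)
  have upos: "0 < u t k" if "0 < t" "t \<le> 1" "k \<le> N" for t k
    unfolding u_def P_def by (rule coeff_bernoulli_poly_pos) (use that tp I N_def in auto)
  have unn: "0 \<le> u t k" if "0 \<le> t" "t \<le> 1" for t k
    unfolding u_def P_def using that p I
    by (intro coeff_bernoulli_poly_nonneg) (auto intro!: mult_nonneg_nonneg mult_le_one simp: less_imp_le)
  have au: "a t k = real (Suc k) * u t (Suc k)" for t k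
    by (simp add: a_def u_def coeff_pderiv)
  have aN: "a t N = 0" for t
    using I by (simp add: au u_def P_def N_def coeff_bernoulli_poly_eq_0)
  have suma: "(\<Sum>k\<le>N. a t k) = t * lam" for t
    unfolding a_def P_def lam N_def using I
    by (subst sum_coeff_pderiv_bernoulli_poly) (auto simp: sum_distrib_left)
  \<comment> \<open>The derivative of \<open>t * lam\<close> cancels the extra \<open>lam\<close> in
    the derivative of \<open>t * lam * ln (t * lam)\<close>.\<close>
  have D': "(D has_real_derivative
      ((\<Sum>k\<le>N. (real k * u t k - a t k) / t * (ln (u t k) + 1)) +
       (\<Sum>k\<le>N. (real k * u t k - a t k) / t * ln (fact k)) - lam * ln (t * lam))) (at t)"
    (is "(D has_real_derivative ?d t) _") if t: "0 < t" "t < 1" for t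
  proof -
    have [derivative_intros]: "((\<lambda>t. u t k) has_real_derivative (real k * u t k - a t k) / t) (at t)" for k
      unfolding u_def a_def P_def using I t by (intro has_real_derivative_coeff_bernoulli_poly) auto
    have ul: "((\<lambda>t. u t k * ln (u t k)) has_real_derivative (real k * u t k - a t k) / t * (ln (u t k) + 1)) (at t)"
      if "k \<le> N" for k
      using upos[of t k] t that by (auto intro!: derivative_eq_intros simp: field_simps)
    have tl: "((\<lambda>t. t * lam * ln (t * lam)) has_real_derivative lam * ln (t * lam) + lam) (at t)"
      using t lam0 by (auto intro!: derivative_eq_intros simp: field_simps)
    show ?thesis unfolding D_def[abs_def]
      by (rule derivative_eq_intros ul tl refl | simp)+
  qed
  have d_le: "?d t \<le> c / lam" if t: "0 < t" "t < 1" for t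
  proof -
    define L where "L k = ln (u t k) + ln (fact k)" for k
    have tl0: "0 < t * lam" using t lam0 by simp
    \<comment> \<open>This is size biasing: \<open>k * u t k\<close> equals
      \<open>a t (k - 1)\<close> for positive \<open>k\<close>.\<close>
    have shift: "(\<Sum>k\<le>N. real k * u t k * g k) = (\<Sum>k\<le>N. a t k * g (Suc k))" for g
    proof -
      have "(\<Sum>k\<le>N. real k * u t k * g k) = (\<Sum>k\<le>N. if k = 0 then 0 else a t (k - 1) * g (Suc (k - 1)))"
        by (intro sum.cong) (auto simp: au)
      also have "\<dots> = (\<Sum>k\<le>N. a t k * g (Suc k))"
        by (rule sum_shift_down[where g = "\<lambda>k. a t k * g (Suc k)"]) (simp add: aN)
      finally show ?thesis .
    qed
    have "(\<Sum>k\<le>N. e k / t * (ln (u t k) + 1)) + (\<Sum>k\<le>N. e k / t * ln (fact k)) =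
        (\<Sum>k\<le>N. e k * (L k + 1)) / t" for e
      unfolding sum.distrib[symmetric] sum_divide_distrib
      by (intro sum.cong) (auto simp: L_def add_divide_distrib algebra_simps)
    then have "t * ?d t = (\<Sum>k\<le>N. (real k * u t k - a t k) * (L k + 1)) - t * lam * ln (t * lam)"
      using t by (simp add: right_diff_distrib)
    also have "(\<Sum>k\<le>N. (real k * u t k - a t k) * (L k + 1)) =
        (\<Sum>k\<le>N. real k * u t k * (L k + 1)) - (\<Sum>k\<le>N. a t k * (L k + 1))"
      by (simp add: left_diff_distrib sum_subtractf)
    also have "\<dots> = (\<Sum>k\<le>N. a t k * (L (Suc k) - L k))"
      unfolding shift sum_subtractf[symmetric] by (intro sum.cong) (auto simp: algebra_simps)
    \<comment> \<open>The result is \<open>t * lam\<close> times the relative entropy of the law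
      \<open>a t k / (t * lam)\<close> with respect to \<open>u t\<close>.\<close>
    also have "\<dots> - t * lam * ln (t * lam) = (\<Sum>k\<le>N. a t k * (L (Suc k) - L k - ln (t * lam)))"
      unfolding suma[of t, symmetric] sum_distrib_right sum_subtractf[symmetric]
      by (intro sum.cong) (auto simp: algebra_simps)
    \<comment> \<open>The inequality \<open>ln x \<le> x - 1\<close> passes to the chi-square
      distance. The index \<open>N\<close> is separate since \<open>u t (Suc N)\<close> vanishes
      there.\<close>
    also have "\<dots> \<le> (\<Sum>k\<le>N. (a t k)\<^sup>2 / u t k / (t * lam) - a t k)"
    proof (rule sum_mono)
      fix k assume "k \<in> {..N}"
      show "a t k * (L (Suc k) - L k - ln (t * lam)) \<le> (a t k)\<^sup>2 / u t k / (t * lam) - a t k"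
      proof (cases "k = N")
        case False
        then have uk: "0 < u t k" "0 < u t (Suc k)" using \<open>k \<in> {..N}\<close> t upos by auto
        have a0: "0 < a t k" unfolding au using uk by simp
        have "L (Suc k) - L k - ln (t * lam) = ln (a t k / (u t k * (t * lam)))"
        proof -
          have "ln (fact (Suc k) :: real) = ln (real (Suc k)) + ln (fact k)"
            unfolding fact_Suc by (subst ln_mult) auto
          moreover have "ln (a t k / (u t k * (t * lam))) =
             ln (real (Suc k)) + ln (u t (Suc k)) - (ln (u t k) + ln (t * lam))"
            using uk tl0 a0 unfolding au by (subst ln_div) (auto simp: ln_mult simp del: of_nat_Suc)
          ultimately show ?thesis by (simp add: L_def)
        qed
        also have "\<dots> \<le> a t k / (u t k * (t * lam)) - 1"
          using a0 uk tl0 by (intro ln_le_minus_one) auto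
        finally have "a t k * (L (Suc k) - L k - ln (t * lam)) \<le> a t k * (a t k / (u t k * (t * lam)) - 1)"
          using a0 by (intro mult_left_mono) auto
        then show ?thesis by (simp add: algebra_simps power2_eq_square)
      qed (simp add: aN)
    qed
    also have "\<dots> = (\<Sum>k\<le>N. (a t k)\<^sup>2 / u t k) / (t * lam) - t * lam"
      by (simp add: sum_subtractf suma sum_divide_distrib)
    \<comment> \<open>The square of the mean cancels against \<open>t * lam\<close>, which leaves
      only the cubic terms.\<close>
    also have "\<dots> \<le> ((t * lam)\<^sup>2 + (\<Sum>j\<in>I. (t * p j) ^ 3 / (1 - t * p j))) / (t * lam) - t * lam"
    proof -
      have "(\<Sum>k\<le>N. (a t k)\<^sup>2 / u t k) \<le> (\<Sum>j\<in>I. t * p j)\<^sup>2 + (\<Sum>j\<in>I. (t * p j) ^ 3 / (1 - t * p j))"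
        unfolding a_def u_def P_def
        by (rule sum_size_bias_square_le) (use t I tp N_def in auto)
      then show ?thesis using tl0
        by (intro diff_right_mono divide_right_mono) (auto simp: lam sum_distrib_left)
    qed
    also have "\<dots> = (\<Sum>j\<in>I. (t * p j) ^ 3 / (1 - t * p j)) / (t * lam)"
      using tl0 by (simp add: add_divide_distrib power2_eq_square)
    also have "\<dots> \<le> (t ^ 3 * c) / (t * lam)"
    proof (intro divide_right_mono)
      have "(t * p j) ^ 3 / (1 - t * p j) \<le> t ^ 3 * ((p j) ^ 3 / (1 - p j))" if "j \<in> I" for j
      proof -
        have pj: "0 < p j" "p j < 1" "t * p j \<le> p j"
          using p[OF that] t mult_left_le_one_le[of "p j" t] by auto
        then have "(t * p j) ^ 3 / (1 - t * p j) \<le> (t * p j) ^ 3 / (1 - p j)"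
          using t tp[OF _ _ that, of t] by (intro divide_left_mono mult_pos_pos) auto
        then show ?thesis by (simp add: power_mult_distrib)
      qed
      then show "(\<Sum>j\<in>I. (t * p j) ^ 3 / (1 - t * p j)) \<le> t ^ 3 * c"
        unfolding c_def sum_distrib_left by (intro sum_mono)
    qed (use tl0 in auto)
    also have "\<dots> = t * (t * (c / lam))" using t lam0 by (simp add: power3_eq_cube)
    finally have "?d t \<le> t * (c / lam)" using t by (simp only: mult_le_cancel_left_pos)
    also have "\<dots> \<le> c / lam" using t c0 lam0 by (intro mult_left_le_one_le) auto
    finally show ?thesis .
  qed
  have cont: "continuous_on {0..1} D"
  proof -
    have xlx: "continuous_on {0..1} (\<lambda>t. f t * ln (f t))"
      if "continuous_on {0..1} f" "\<And>t. t \<in> {0..1} \<Longrightarrow> 0 \<le> f t" for f :: "real \<Rightarrow> real"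
      by (rule continuous_on_compose2[OF continuous_on_x_ln_x that(1)]) (use that(2) in auto)
    have u: "continuous_on {0..1} (\<lambda>t. u t k)" for k
      unfolding u_def P_def by (rule continuous_on_coeff_bernoulli_poly) fact
    show ?thesis unfolding D_def[abs_def]
      by (intro continuous_intros u xlx) (use unn lam0 in auto)
  qed
  \<comment> \<open>At \<open>t = 0\<close> both laws are the point mass at 0.\<close>
  have D0: "D 0 = 0"
  proof -
    have "u 0 k = (if k = 0 then 1 else 0)" for k
      by (simp add: u_def P_def bernoulli_poly_def coeff_1 flip: one_pCons)
    then have "(\<Sum>k\<le>N. u 0 k * ln (u 0 k)) = 0" "(\<Sum>k\<le>N. u 0 k * ln (fact k)) = 0"
      by (auto intro!: sum.neutral)
    then show ?thesis by (simp add: D_def)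
  qed
  obtain l z where lz: "0 < z" "z < 1" "(D has_real_derivative l) (at z)" "D 1 - D 0 = (1 - 0) * l"
  proof -
    have "D differentiable (at x)" if "0 < x" "x < 1" for x
      unfolding real_differentiable_def using D'[OF that] by (rule exI)
    then show ?thesis using MVT[of 0 1 D, OF zero_less_one cont] that by blast
  qed
  have "l = ?d z" using lz(3) D'[OF lz(1,2)] by (rule DERIV_unique)
  then have "D 1 \<le> c / lam" using lz d_le[of z] D0 by auto
  then show ?thesis unfolding D_def c_def w_def u_def P_def N_def by simp
qed

subsection \<open>Replacing Bernoulli variables by Poisson variables\<close>

text \<open>This is convolution. The monadic form makes associativity and commutativity consequences
  of the monad laws.\<close>

definition add_pmf :: "nat pmf \<Rightarrow> nat pmf \<Rightarrow> nat pmf" where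
  "add_pmf S T = bind_pmf S (\<lambda>s. map_pmf (\<lambda>t. s + t) T)"

lemma add_pmf_assoc: "add_pmf (add_pmf S T) U = add_pmf S (add_pmf T U)"
  by (simp add: add_pmf_def map_pmf_def bind_assoc_pmf bind_return_pmf add.assoc)

lemma add_pmf_commute: "add_pmf S T = add_pmf T S"
  unfolding add_pmf_def map_pmf_def by (subst bind_commute_pmf) (simp add: add.commute)

lemma add_pmf_return_0 [simp]: "add_pmf S (return_pmf 0) = S" "add_pmf (return_pmf 0) S = S"
  by (simp_all add: add_pmf_def bind_return_pmf bind_return_pmf' map_pmf_def)

lemma nn_integral_add_pmf [simp]:
  "(\<integral>\<^sup>+x. f x \<partial>add_pmf S T) = (\<integral>\<^sup>+s. \<integral>\<^sup>+t. f (s + t) \<partial>T \<partial>S)"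
  by (simp add: add_pmf_def)

lemma pmf_add_pmf: "pmf (add_pmf S T) k = (\<Sum>i\<le>k. pmf S i * pmf T (k - i))"
proof -
  have "pmf (map_pmf (\<lambda>t. s + t) T) k = (if s \<le> k then pmf T (k - s) else 0)" for s
  proof (cases "s \<le> k")
    case True
    then show ?thesis using pmf_map_inj'[of "\<lambda>t. s + t" T "k - s"] by (simp add: inj_def)
  next
    case False
    then have "k \<notin> set_pmf (map_pmf (\<lambda>t. s + t) T)" by auto
    then show ?thesis using False by (simp add: set_pmf_iff del: set_map_pmf pmf.set_map)
  qed
  then show ?thesis
    unfolding add_pmf_def pmf_bind
    by (subst integral_measure_pmf_real[of "{..k}"]) (auto intro!: sum.cong simp: mult.commute split: if_splits)
qed

text \<open>\<open>poisson_pmf\<close> is only specified for positive rates.\<close>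

definition poisson0_pmf :: "real \<Rightarrow> nat pmf" where
  "poisson0_pmf a = (if 0 < a then poisson_pmf a else return_pmf 0)"

lemma pmf_poisson0: "0 \<le> a \<Longrightarrow> pmf (poisson0_pmf a) k = a ^ k / fact k * exp (- a)"
  by (auto simp: poisson0_pmf_def power_0_left)

lemma add_pmf_poisson0:
  assumes "0 \<le> a" "0 \<le> b"
  shows "add_pmf (poisson0_pmf a) (poisson0_pmf b) = poisson0_pmf (a + b)"
proof (rule pmf_eqI)
  fix k
  have "(\<Sum>i\<le>k. a ^ i / fact i * exp (- a) * (b ^ (k - i) / fact (k - i) * exp (- b)))
    = (\<Sum>i\<le>k. of_nat (k choose i) * a ^ i * b ^ (k - i)) / fact k * exp (- (a + b))"
    unfolding sum_divide_distrib sum_distrib_right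
    by (intro sum.cong) (auto simp: binomial_fact exp_diff exp_minus field_simps exp_add)
  then show "pmf (add_pmf (poisson0_pmf a) (poisson0_pmf b)) k = pmf (poisson0_pmf (a + b)) k"
    using assms by (simp add: pmf_add_pmf pmf_poisson0 binomial_ring)
qed

text \<open>Poisson weights satisfy \<open>(k + 1) * v (k + 1) = a * v k\<close>. With values in
  \<open>ennreal\<close> no integrability of \<open>g\<close> has to be discussed.\<close>

lemma nn_integral_poisson0_size_bias:
  assumes "0 \<le> a"
  shows "(\<integral>\<^sup>+k. of_nat k * g k \<partial>poisson0_pmf a) = ennreal a * (\<integral>\<^sup>+k. g (Suc k) \<partial>poisson0_pmf a)"
proof -
  let ?v = "\<lambda>k. ennreal (pmf (poisson0_pmf a) k)"
  have eq: "?v (Suc k) * of_nat (Suc k) = ennreal a * ?v k" for k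
  proof -
    have "pmf (poisson0_pmf a) (Suc k) * real (Suc k) = a * pmf (poisson0_pmf a) k"
      using assms by (simp add: pmf_poisson0 field_simps del: of_nat_Suc)
    then show ?thesis
      using assms by (metis ennreal_mult' ennreal_of_nat_eq_real_of_nat of_nat_0_le_iff ennreal_mult'')
  qed
  have "(\<integral>\<^sup>+k. of_nat k * g k \<partial>poisson0_pmf a) = (\<Sum>k. ?v k * (of_nat k * g k))"
    by (simp add: nn_integral_measure_pmf nn_integral_count_space_nat)
  also have "\<dots> = (\<Sum>k. ?v (Suc k) * (of_nat (Suc k) * g (Suc k)))"
  proof -
    have "(\<lambda>k. ?v (Suc k) * (of_nat (Suc k) * g (Suc k))) sums (\<Sum>k. ?v (Suc k) * (of_nat (Suc k) * g (Suc k)))"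
      by (intro summable_sums summableI)
    from sums_Suc[OF this] show ?thesis by (simp add: sums_iff)
  qed
  also have "\<dots> = (\<Sum>k. ennreal a * (?v k * g (Suc k)))"
    by (simp only: mult.assoc[symmetric] eq)
  also have "\<dots> = ennreal a * (\<integral>\<^sup>+k. g (Suc k) \<partial>poisson0_pmf a)"
    by (simp add: nn_integral_measure_pmf nn_integral_count_space_nat)
  finally show ?thesis .
qed

lemma nn_integral_poisson0_id:
  "0 \<le> a \<Longrightarrow> (\<integral>\<^sup>+k. of_nat k \<partial>poisson0_pmf a) = ennreal a"
  using nn_integral_poisson0_size_bias[of a "\<lambda>_. 1"] by simp

lemma nn_integral_poisson0_factorial_moment:
  assumes "0 \<le> a"
  shows "(\<integral>\<^sup>+k. of_nat (k * (k - 1)) \<partial>poisson0_pmf a) = ennreal (a\<^sup>2)"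
  using nn_integral_poisson0_size_bias[of a "\<lambda>k. of_nat (k - 1)"] assms
  by (simp add: nn_integral_poisson0_id ennreal_mult power2_eq_square)

definition bernoulli_nat_pmf :: "real \<Rightarrow> nat pmf" where
  "bernoulli_nat_pmf p = map_pmf of_bool (bernoulli_pmf p)"

lemma bernoulli_sum_pmf_Suc_add:
  "bernoulli_sum_pmf (Suc n) p = add_pmf (bernoulli_nat_pmf (p (Suc n))) (bernoulli_sum_pmf n p)"
  by (simp add: bernoulli_sum_pmf_Suc add_pmf_def bernoulli_nat_pmf_def bind_map_pmf)

lemma nn_integral_bernoulli_nat_pmf:
  assumes "0 \<le> p" "p \<le> 1"
  shows "(\<integral>\<^sup>+x. f x \<partial>bernoulli_nat_pmf p) = ennreal p * f 1 + ennreal (1 - p) * f 0"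
  using assms by (simp add: bernoulli_nat_pmf_def mult.commute)

text \<open>The identity \<open>\<mu> E g(S + 1) = E (S g(S))\<close> for all \<open>g\<close> characterises the Poisson law with mean
  \<open>\<mu>\<close> (Chen--Stein).\<close>

definition size_bias_le :: "nat pmf \<Rightarrow> real \<Rightarrow> bool" where
  "size_bias_le S \<mu> \<longleftrightarrow> (\<forall>g :: nat \<Rightarrow> ennreal. antimono g \<longrightarrow>
     ennreal \<mu> * (\<integral>\<^sup>+s. g (Suc s) \<partial>S) \<le> (\<integral>\<^sup>+s. of_nat s * g s \<partial>S))"

lemma size_bias_le_return: "size_bias_le (return_pmf k) 0"
  by (simp add: size_bias_le_def)

lemma size_bias_le_poisson0: "0 \<le> a \<Longrightarrow> size_bias_le (poisson0_pmf a) a"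
  by (simp add: size_bias_le_def nn_integral_poisson0_size_bias)

text \<open>Only the values \<open>g 1\<close> and \<open>g 2\<close> enter on the left, and
  \<open>g 2 \<le> g 1\<close> is where monotonicity is used.\<close>

lemma size_bias_le_bernoulli:
  assumes "0 \<le> p" "p \<le> 1"
  shows "size_bias_le (bernoulli_nat_pmf p) p"
  unfolding size_bias_le_def
proof (intro allI impI)
  fix g :: "nat \<Rightarrow> ennreal" assume "antimono g"
  then have g: "g (Suc 1) \<le> g 1" by (rule antimonoD) simp
  have "ennreal p * g (Suc 1) + ennreal (1 - p) * g 1 \<le> ennreal p * g 1 + ennreal (1 - p) * g 1"
    using g by (intro add_mono mult_left_mono) auto
  also have "\<dots> = g 1" using assms by (simp add: distrib_right[symmetric] ennreal_plus[symmetric] del: ennreal_plus)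
  finally show "ennreal p * (\<integral>\<^sup>+s. g (Suc s) \<partial>bernoulli_nat_pmf p) \<le> (\<integral>\<^sup>+s. of_nat s * g s \<partial>bernoulli_nat_pmf p)"
    using assms by (simp add: nn_integral_bernoulli_nat_pmf mult_left_mono)
qed

text \<open>Fix one summand and apply the inequality for the other to a translate of
  \<open>g\<close>, which is again antitone; then add the two results.\<close>

lemma size_bias_le_add:
  assumes "size_bias_le S \<mu>" "size_bias_le T \<nu>" "0 \<le> \<mu>" "0 \<le> \<nu>"
  shows "size_bias_le (add_pmf S T) (\<mu> + \<nu>)"
  unfolding size_bias_le_def
proof (intro allI impI)
  fix g :: "nat \<Rightarrow> ennreal" assume g: "antimono g"
  have anti: "antimono (\<lambda>k. g (m + k))" "antimono (\<lambda>k. g (k + m))" for m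
    using g by (auto intro!: antimonoI intro: antimonoD)
  \<comment> \<open>Fubini for two discrete laws, obtained from commutativity of
    \<open>bind_pmf\<close>.\<close>
  have swap: "(\<integral>\<^sup>+s. \<integral>\<^sup>+t. h s t \<partial>T \<partial>S) = (\<integral>\<^sup>+t. \<integral>\<^sup>+s. h s t \<partial>S \<partial>T)" for h :: "nat \<Rightarrow> nat \<Rightarrow> ennreal"
  proof -
    have "(\<integral>\<^sup>+x. (case x of (s, t) \<Rightarrow> h s t) \<partial>bind_pmf S (\<lambda>s. bind_pmf T (\<lambda>t. return_pmf (s, t)))) =
      (\<integral>\<^sup>+x. (case x of (s, t) \<Rightarrow> h s t) \<partial>bind_pmf T (\<lambda>t. bind_pmf S (\<lambda>s. return_pmf (s, t))))"
      by (subst bind_commute_pmf) simp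
    then show ?thesis by simp
  qed
  have 1: "ennreal \<mu> * (\<integral>\<^sup>+s. g (Suc s + t) \<partial>S) \<le> (\<integral>\<^sup>+s. of_nat s * g (s + t) \<partial>S)" for t
    using assms(1) anti unfolding size_bias_le_def by blast
  have 2: "ennreal \<nu> * (\<integral>\<^sup>+t. g (s + Suc t) \<partial>T) \<le> (\<integral>\<^sup>+t. of_nat t * g (s + t) \<partial>T)" for s
    using assms(2) anti unfolding size_bias_le_def by blast
  have "ennreal (\<mu> + \<nu>) * (\<integral>\<^sup>+x. g (Suc x) \<partial>add_pmf S T) =
      (\<integral>\<^sup>+t. ennreal \<mu> * (\<integral>\<^sup>+s. g (Suc s + t) \<partial>S) \<partial>T) + (\<integral>\<^sup>+s. ennreal \<nu> * (\<integral>\<^sup>+t. g (s + Suc t) \<partial>T) \<partial>S)"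
    using assms by (simp add: nn_integral_cmult distrib_right swap[symmetric])
  also have "\<dots> \<le> (\<integral>\<^sup>+t. \<integral>\<^sup>+s. of_nat s * g (s + t) \<partial>S \<partial>T) + (\<integral>\<^sup>+s. \<integral>\<^sup>+t. of_nat t * g (s + t) \<partial>T \<partial>S)"
    by (intro add_mono nn_integral_mono 1 2)
  also have "\<dots> = (\<integral>\<^sup>+x. of_nat x * g x \<partial>add_pmf S T)"
    by (simp add: swap[symmetric] distrib_right nn_integral_add)
  finally show "ennreal (\<mu> + \<nu>) * (\<integral>\<^sup>+x. g (Suc x) \<partial>add_pmf S T) \<le> (\<integral>\<^sup>+x. of_nat x * g x \<partial>add_pmf S T)" .
qed

text \<open>Test with \<open>g s = 1 / max 1 s\<close>, for which \<open>s * g s \<le> 1\<close>.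
  The maximum keeps \<open>g\<close> antitone at 0, where \<open>1 / 0 = 0\<close> would break
  it.\<close>

lemma nn_integral_inverse_Suc_le:
  assumes "size_bias_le S \<mu>"
  shows "ennreal \<mu> * (\<integral>\<^sup>+s. ennreal (1 / real (Suc s)) \<partial>S) \<le> 1"
proof -
  let ?g = "\<lambda>s. ennreal (1 / max 1 (real s))"
  have "antimono ?g"
    by (intro antimonoI ennreal_leI divide_left_mono) auto
  then have "ennreal \<mu> * (\<integral>\<^sup>+s. ?g (Suc s) \<partial>S) \<le> (\<integral>\<^sup>+s. of_nat s * ?g s \<partial>S)"
    using assms unfolding size_bias_le_def by blast
  also have "\<dots> \<le> (\<integral>\<^sup>+s. 1 \<partial>S)"
  proof (rule nn_integral_mono)
    fix s :: nat
    have "of_nat s * ?g s = ennreal (real s * (1 / max 1 (real s)))"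
      by (subst ennreal_mult) (auto simp: ennreal_of_nat_eq_real_of_nat)
    also have "\<dots> \<le> 1" by (auto simp: max_def)
    finally show "of_nat s * ?g s \<le> 1" .
  qed
  finally show ?thesis by (simp add: max_def)
qed

section \<open>Cost of one replacement in the expected log-factorial\<close>

text \<open>Each new factor obeys \<open>ln (s + i) \<le> ln (s + 1) + (i - 1) / (s + 1)\<close>.
  Summing over \<open>i\<close> up to \<open>y\<close> produces half of \<open>y * (y - 1)\<close>,
  whose Poisson mean is explicit.\<close>

lemma ln_fact_add_le:
  "ln (fact (s + y)) \<le> ln (fact s) + real y * ln (real (Suc s)) + real (y * (y - 1)) * (1 / (2 * real (Suc s)))"
proof (induction y)
  case (Suc y)
  have "ln (fact (s + Suc y) :: real) = ln (real (Suc (s + y))) + ln (fact (s + y))"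
    unfolding add_Suc_right fact_Suc by (subst ln_mult) auto
  also have "ln (real (Suc (s + y))) \<le> ln (real (Suc s)) + real y / real (Suc s)"
  proof -
    have "ln (real (Suc (s + y))) - ln (real (Suc s)) = ln (real (Suc (s + y)) / real (Suc s))"
      by (subst ln_div) auto
    also have "\<dots> \<le> real (Suc (s + y)) / real (Suc s) - 1"
      by (intro ln_le_minus_one) auto
    also have "\<dots> = real y / real (Suc s)" by (simp add: field_simps)
    finally show ?thesis by simp
  qed
  also note Suc.IH
  finally have "ln (fact (s + Suc y)) \<le> ln (fact s) + real (Suc y) * ln (real (Suc s)) +
      (real y / real (Suc s) + real (y * (y - 1)) * (1 / (2 * real (Suc s))))"
    by (simp add: algebra_simps del: fact_Suc)
  also have "real y / real (Suc s) + real (y * (y - 1)) * (1 / (2 * real (Suc s))) =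
      real (Suc y * (Suc y - 1)) * (1 / (2 * real (Suc s)))"
    by (cases y) (auto simp add: divide_simps simp del: of_nat_Suc, simp add: algebra_simps)
  finally show ?case .
qed simp

lemma nn_integral_ln_fact_add_poisson0_le:
  assumes "0 \<le> a"
  shows "(\<integral>\<^sup>+x. ennreal (ln (fact x)) \<partial>add_pmf S (poisson0_pmf a)) \<le>
    (\<integral>\<^sup>+s. ennreal (ln (fact s) + a * ln (real (Suc s)) + a\<^sup>2 / 2 * (1 / real (Suc s))) \<partial>S)"
proof -
  have "(\<integral>\<^sup>+y. ennreal (ln (fact (s + y))) \<partial>poisson0_pmf a) \<le>
      ennreal (ln (fact s) + a * ln (real (Suc s)) + a\<^sup>2 / 2 * (1 / real (Suc s)))" for s
  proof -
    have nn: "0 \<le> ln (fact s :: real)" "0 \<le> ln (real (Suc s))" by (auto simp: fact_ge_1)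
    have "(\<integral>\<^sup>+y. ennreal (ln (fact (s + y))) \<partial>poisson0_pmf a) \<le>
      (\<integral>\<^sup>+y. ennreal (ln (fact s)) + of_nat y * ennreal (ln (real (Suc s))) +
         of_nat (y * (y - 1)) * ennreal (1 / (2 * real (Suc s))) \<partial>poisson0_pmf a)"
    proof (rule nn_integral_mono)
      fix y
      have "ennreal (ln (fact (s + y))) \<le> ennreal (ln (fact s) + real y * ln (real (Suc s)) +
          real (y * (y - 1)) * (1 / (2 * real (Suc s))))"
        by (intro ennreal_leI ln_fact_add_le)
      also have "\<dots> = ennreal (ln (fact s)) + of_nat y * ennreal (ln (real (Suc s))) +
         of_nat (y * (y - 1)) * ennreal (1 / (2 * real (Suc s)))"
        unfolding ennreal_of_nat_eq_real_of_nat using nn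
        by (subst (1 2) ennreal_mult[symmetric], simp_all del: of_nat_Suc of_nat_mult)
      finally show "ennreal (ln (fact (s + y))) \<le> \<dots>" .
    qed
    also have "\<dots> = ennreal (ln (fact s)) + ennreal a * ennreal (ln (real (Suc s))) +
         ennreal (a\<^sup>2) * ennreal (1 / (2 * real (Suc s)))"
      using assms
      by (simp add: nn_integral_add nn_integral_multc nn_integral_poisson0_id
          nn_integral_poisson0_factorial_moment[unfolded One_nat_def] del: of_nat_Suc of_nat_mult)
    also have "\<dots> = ennreal (ln (fact s) + a * ln (real (Suc s)) + a\<^sup>2 / 2 * (1 / real (Suc s)))"
      using nn assms by (simp add: ennreal_mult[symmetric] ennreal_plus[symmetric] del: of_nat_Suc ennreal_plus)
    finally show ?thesis .
  qed
  then show ?thesis by (simp add: nn_integral_mono)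
qed

text \<open>A Bernoulli variable has no second factorial moment, so the first-order expansion is
  exact.\<close>

lemma nn_integral_ln_fact_add_bernoulli:
  assumes "0 \<le> p" "p \<le> 1"
  shows "(\<integral>\<^sup>+x. ennreal (ln (fact x)) \<partial>add_pmf S (bernoulli_nat_pmf p)) =
    (\<integral>\<^sup>+s. ennreal (ln (fact s) + p * ln (real (Suc s))) \<partial>S)"
proof -
  have "ennreal p * ennreal (ln (fact (Suc s))) + ennreal (1 - p) * ennreal (ln (fact s)) =
     ennreal (ln (fact s) + p * ln (real (Suc s)))" for s
  proof -
    have nn: "0 \<le> ln (fact s :: real)" "0 \<le> ln (real (Suc s))" "0 \<le> ln (fact (Suc s) :: real)"
      by (auto simp: fact_ge_1 simp del: fact_Suc)
    have "ln (fact (Suc s) :: real) = ln (real (Suc s)) + ln (fact s)"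
      unfolding fact_Suc by (subst ln_mult) auto
    then have eq: "ln (fact s) + p * ln (real (Suc s)) = p * ln (fact (Suc s)) + (1 - p) * ln (fact s)"
      by (simp add: algebra_simps del: of_nat_Suc fact_Suc)
    show ?thesis
      unfolding eq using nn assms by (simp add: ennreal_mult del: of_nat_Suc fact_Suc)
  qed
  then show ?thesis
    using assms by (simp add: nn_integral_bernoulli_nat_pmf del: fact_Suc of_nat_Suc)
qed

text \<open>The first-order terms of both variables agree. The difference is at most
  \<open>p\<^sup>2 / 2\<close> times the inverse moment \<open>E\<close> of
  \<open>S + 1\<close>.\<close>

lemma nn_integral_ln_fact_replace_bernoulli:
  assumes "0 \<le> p" "p \<le> 1" "0 < lam" "size_bias_le S (lam - p)"
  shows "(\<integral>\<^sup>+x. ennreal (ln (fact x)) \<partial>add_pmf S (poisson0_pmf p)) \<le>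
    (\<integral>\<^sup>+x. ennreal (ln (fact x)) \<partial>add_pmf S (bernoulli_nat_pmf p)) + ennreal (p\<^sup>2 / lam)"
proof -
  define E where "E = (\<integral>\<^sup>+s. ennreal (1 / real (Suc s)) \<partial>S)"
  have E1: "E \<le> 1"
  proof -
    have "E \<le> (\<integral>\<^sup>+s. 1 \<partial>S)" unfolding E_def by (intro nn_integral_mono) auto
    then show ?thesis by simp
  qed
  then have "E \<noteq> \<top>" by (metis ennreal_one_neq_top neq_top_trans)
  then obtain e where e: "E = ennreal e" "0 \<le> e" by (cases E) auto
  \<comment> \<open>For \<open>lam \<le> 2\<close> the trivial bound \<open>E \<le> 1\<close>
    suffices. Otherwise \<open>p \<le> 1\<close> gives \<open>lam - p \<ge> lam / 2\<close>, and the
    inverse-moment bound applies.\<close>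
  have "e \<le> 2 / lam"
  proof (cases "lam \<le> 2")
    case True
    then have "1 \<le> 2 / lam" using assms by simp
    moreover have "e \<le> 1" using E1 e by simp
    ultimately show ?thesis by linarith
  next
    case False
    have "ennreal (lam - p) * E \<le> 1"
      unfolding E_def by (intro nn_integral_inverse_Suc_le assms)
    then have "(lam - p) * e \<le> 1"
      using e False assms by (simp add: ennreal_mult[symmetric])
    moreover have "lam / 2 * e \<le> (lam - p) * e" using False assms e by (intro mult_right_mono) auto
    ultimately show ?thesis using assms by (simp add: field_simps)
  qed
  then have "p\<^sup>2 / 2 * e \<le> p\<^sup>2 / 2 * (2 / lam)" by (intro mult_left_mono) auto
  then have pe: "ennreal (p\<^sup>2 / 2) * E \<le> ennreal (p\<^sup>2 / lam)"
    using e by (simp add: ennreal_mult[symmetric] ennreal_leI)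
  have "(\<integral>\<^sup>+x. ennreal (ln (fact x)) \<partial>add_pmf S (poisson0_pmf p)) \<le>
      (\<integral>\<^sup>+s. ennreal (ln (fact s) + p * ln (real (Suc s)) + p\<^sup>2 / 2 * (1 / real (Suc s))) \<partial>S)"
    by (rule nn_integral_ln_fact_add_poisson0_le) fact
  also have "\<dots> = (\<integral>\<^sup>+s. ennreal (ln (fact s) + p * ln (real (Suc s))) + ennreal (p\<^sup>2 / 2) * ennreal (1 / real (Suc s)) \<partial>S)"
    using assms by (intro nn_integral_cong) (subst ennreal_plus, auto simp: fact_ge_1 ennreal_mult[symmetric])
  also have "\<dots> = (\<integral>\<^sup>+x. ennreal (ln (fact x)) \<partial>add_pmf S (bernoulli_nat_pmf p)) + ennreal (p\<^sup>2 / 2) * E"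
    using assms by (simp only: nn_integral_ln_fact_add_bernoulli E_def) (simp add: nn_integral_add nn_integral_cmult)
  also have "\<dots> \<le> (\<integral>\<^sup>+x. ennreal (ln (fact x)) \<partial>add_pmf S (bernoulli_nat_pmf p)) + ennreal (p\<^sup>2 / lam)"
    by (intro add_left_mono pe)
  finally show ?thesis .
qed

text \<open>The summand \<open>R\<close>, with parameter \<open>\<mu>\<close>, collects the
  variables that are already Bernoulli. The total \<open>lam\<close> stays fixed, so every
  replacement costs at most its own \<open>(p j)\<^sup>2 / lam\<close>.\<close>

lemma nn_integral_ln_fact_poisson0_le_bernoulli_sum:
  assumes "\<And>j. j \<in> {1..n} \<Longrightarrow> 0 \<le> p j \<and> p j \<le> 1" "size_bias_le R \<mu>" "0 \<le> \<mu>"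
    and "0 < lam" "lam = \<mu> + (\<Sum>j=1..n. p j)"
  shows "(\<integral>\<^sup>+x. ennreal (ln (fact x)) \<partial>add_pmf R (poisson0_pmf (\<Sum>j=1..n. p j))) \<le>
    (\<integral>\<^sup>+x. ennreal (ln (fact x)) \<partial>add_pmf R (bernoulli_sum_pmf n p)) + ennreal ((\<Sum>j=1..n. (p j)\<^sup>2) / lam)"
  using assms
proof (induction n arbitrary: R \<mu>)
  case 0
  then show ?case by (simp add: poisson0_pmf_def bernoulli_sum_pmf_0)
next
  case (Suc n)
  let ?F = "\<lambda>S. \<integral>\<^sup>+x. ennreal (ln (fact x)) \<partial>measure_pmf S"
  define q where "q = p (Suc n)"
  define s where "s = (\<Sum>j=1..n. p j)"
  have q: "0 \<le> q" "q \<le> 1" using Suc.prems(1)[of "Suc n"] by (auto simp: q_def)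
  have s0: "0 \<le> s" unfolding s_def using Suc.prems(1) by (intro sum_nonneg) auto
  have lam: "lam - q = \<mu> + s" using Suc.prems by (simp add: q_def s_def)
  have "?F (add_pmf R (poisson0_pmf (s + q))) = ?F (add_pmf (add_pmf R (poisson0_pmf s)) (poisson0_pmf q))"
    using s0 q by (simp only: add_pmf_assoc add_pmf_poisson0)
  also have "\<dots> \<le> ?F (add_pmf (add_pmf R (poisson0_pmf s)) (bernoulli_nat_pmf q)) + ennreal (q\<^sup>2 / lam)"
    unfolding lam[symmetric] using q Suc.prems(2-4) s0 lam
    by (intro nn_integral_ln_fact_replace_bernoulli)
       (auto intro!: size_bias_le_add size_bias_le_poisson0)
  \<comment> \<open>The new Bernoulli variable moves into \<open>R\<close> before the induction
    hypothesis is applied.\<close>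
  also have "add_pmf (add_pmf R (poisson0_pmf s)) (bernoulli_nat_pmf q) =
      add_pmf (add_pmf R (bernoulli_nat_pmf q)) (poisson0_pmf s)"
    by (metis add_pmf_assoc add_pmf_commute)
  also have "?F \<dots> \<le> ?F (add_pmf (add_pmf R (bernoulli_nat_pmf q)) (bernoulli_sum_pmf n p)) +
      ennreal ((\<Sum>j=1..n. (p j)\<^sup>2) / lam)"
    unfolding s_def
  proof (rule Suc.IH)
    show "size_bias_le (add_pmf R (bernoulli_nat_pmf q)) (\<mu> + q)"
      using Suc.prems q by (intro size_bias_le_add size_bias_le_bernoulli) auto
    show "lam = \<mu> + q + (\<Sum>j=1..n. p j)" using lam s_def by simp
  qed (use Suc.prems q in auto)
  also have "add_pmf (add_pmf R (bernoulli_nat_pmf q)) (bernoulli_sum_pmf n p) =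
      add_pmf R (bernoulli_sum_pmf (Suc n) p)"
    by (simp add: bernoulli_sum_pmf_Suc_add add_pmf_assoc q_def)
  finally have "?F (add_pmf R (poisson0_pmf (s + q))) \<le> ?F (add_pmf R (bernoulli_sum_pmf (Suc n) p)) +
      (ennreal ((\<Sum>j=1..n. (p j)\<^sup>2) / lam) + ennreal (q\<^sup>2 / lam))"
    by (simp add: add.assoc)
  also have "ennreal ((\<Sum>j=1..n. (p j)\<^sup>2) / lam) + ennreal (q\<^sup>2 / lam) = ennreal ((\<Sum>j=1..Suc n. (p j)\<^sup>2) / lam)"
    using Suc.prems by (simp add: ennreal_plus[symmetric] add_divide_distrib q_def sum_nonneg del: ennreal_plus)
  finally show ?case by (simp add: s_def q_def)
qed

subsection \<open>Entropy of the Poisson law and of Bernoulli sums\<close>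

lemma pmf_poisson_sums_1:
  assumes "0 < lam"
  shows "pmf (poisson_pmf lam) sums 1"
proof -
  have "(\<lambda>k. lam ^ k / fact k * exp (- lam)) sums (exp lam * exp (- lam))"
    using exp_converges[of lam] by (intro sums_mult2) (simp add: field_simps)
  then show ?thesis using assms by (simp add: exp_minus sums_cong[OF pmf_poisson])
qed

lemma pmf_poisson_mean_sums:
  assumes "0 < lam"
  shows "(\<lambda>k. pmf (poisson_pmf lam) k * real k) sums lam"
proof -
  have "pmf (poisson_pmf lam) (Suc k) * real (Suc k) = lam * pmf (poisson_pmf lam) k" for k
    using assms by (simp add: field_simps del: of_nat_Suc)
  then have "(\<lambda>k. pmf (poisson_pmf lam) (Suc k) * real (Suc k)) sums (lam * 1)"
    using sums_mult[OF pmf_poisson_sums_1[OF assms], of lam] by simp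
  from sums_Suc[OF this] show ?thesis by simp
qed

text \<open>Multiply \<open>ln (v k) = k * ln lam - ln (fact k) - lam\<close> by \<open>v k\<close>
  and sum, using total mass 1 and mean \<open>lam\<close>.\<close>

lemma pmf_poisson_ln_fact_sums:
  assumes "0 < lam"
  shows "(\<lambda>k. pmf (poisson_pmf lam) k * ln (fact k)) sums
    (shannon_entropy (poisson_pmf lam) - lam + lam * ln lam)"
proof -
  let ?v = "pmf (poisson_pmf lam)"
  have "(\<lambda>k. ?v k * ln (?v k)) sums (- shannon_entropy (poisson_pmf lam))"
    using summable_sums[OF summable_entropy_poisson[OF assms]] by (simp add: shannon_entropy_def)
  from sums_diff[OF sums_diff[OF sums_mult2[OF pmf_poisson_mean_sums[OF assms], of "ln lam"]
      sums_mult2[OF pmf_poisson_sums_1[OF assms], of lam]] this]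
  have "(\<lambda>k. ?v k * real k * ln lam - ?v k * lam - ?v k * ln (?v k)) sums
      (lam * ln lam - 1 * lam - - shannon_entropy (poisson_pmf lam))" .
  moreover have "?v k * real k * ln lam - ?v k * lam - ?v k * ln (?v k) = ?v k * ln (fact k)" for k
  proof -
    have "ln (?v k) = real k * ln lam - ln (fact k) - lam"
      using assms by (simp add: ln_mult ln_div ln_realpow)
    then have "?v k * ln (?v k) = ?v k * (real k * ln lam - ln (fact k) - lam)" by (rule arg_cong)
    then show ?thesis by (simp only: right_diff_distrib)
  qed
  ultimately show ?thesis by (simp add: algebra_simps)
qed

lemma nn_integral_poisson0_eq_sums:
  assumes "0 < lam" "\<And>k. 0 \<le> f k" "(\<lambda>k. pmf (poisson_pmf lam) k * f k) sums s"
  shows "(\<integral>\<^sup>+k. ennreal (f k) \<partial>poisson0_pmf lam) = ennreal s"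
proof -
  have "(\<integral>\<^sup>+k. ennreal (f k) \<partial>poisson0_pmf lam) = (\<Sum>k. ennreal (pmf (poisson_pmf lam) k * f k))"
    using assms(1,2)
    by (simp add: nn_integral_measure_pmf nn_integral_count_space_nat poisson0_pmf_def ennreal_mult'' del: pmf_poisson)
  also have "\<dots> = ennreal s"
    using assms(2,3) by (intro suminf_ennreal_eq) (auto simp del: pmf_poisson)
  finally show ?thesis .
qed

lemma nn_integral_poisson0_ln_fact:
  assumes "0 < lam"
  shows "(\<integral>\<^sup>+k. ennreal (ln (fact k)) \<partial>poisson0_pmf lam) =
    ennreal (shannon_entropy (poisson_pmf lam) - lam + lam * ln lam)"
  using assms by (intro nn_integral_poisson0_eq_sums pmf_poisson_ln_fact_sums) (auto simp: fact_ge_1)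

text \<open>Split off a Poisson variable of rate \<open>h\<close> and replace it by a Bernoulli
  variable. The growth \<open>h * ln lam\<close> of the expected log-factorial is cancelled by the
  term \<open>- a * ln a\<close> of the entropy.\<close>

lemma shannon_entropy_poisson_increment:
  assumes "0 < lam" "0 \<le> h" "h \<le> 1"
  shows "shannon_entropy (poisson_pmf (lam + h)) \<le> shannon_entropy (poisson_pmf lam) + 2 * h / lam"
proof -
  let ?H = "\<lambda>a. shannon_entropy (poisson_pmf a)"
  define K where "K a = ?H a - a + a * ln a" for a
  \<comment> \<open>The tangent of \<open>ln\<close> at \<open>lam\<close> replaces
    \<open>ln (k + 1)\<close> by an expression linear in \<open>k\<close>, which integrates
    exactly.\<close>
  define z where "z k = ln (fact k) + h * (ln lam + real (Suc k) / lam - 1)" for k :: nat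
  have ln_le: "ln (real (Suc k)) \<le> ln lam + real (Suc k) / lam - 1" for k
  proof -
    have "ln (real (Suc k) / lam) \<le> real (Suc k) / lam - 1"
      using assms by (intro ln_le_minus_one) auto
    then show ?thesis using assms by (subst (asm) ln_div) auto
  qed
  have z_ge: "ln (fact k) + h * ln (real (Suc k)) \<le> z k" for k
    unfolding z_def using ln_le assms by (intro add_left_mono mult_left_mono)
  have z0: "0 \<le> z k" for k
  proof -
    have "0 \<le> ln (fact k :: real)" by (simp add: fact_ge_1)
    moreover have "0 \<le> h * ln (real (Suc k))" using assms by simp
    ultimately show ?thesis using z_ge[of k] by linarith
  qed
  have "(\<lambda>k. pmf (poisson_pmf lam) k * z k) sums (K lam + (h * (ln lam + 1 / lam - 1) + h))"
  proof -
    have "(\<lambda>k. pmf (poisson_pmf lam) k * ln (fact k) + (pmf (poisson_pmf lam) k * (h * (ln lam + 1 / lam - 1)) +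
        pmf (poisson_pmf lam) k * real k * (h / lam))) sums
        (K lam + (1 * (h * (ln lam + 1 / lam - 1)) + lam * (h / lam)))"
      unfolding K_def using assms(1)
      by (intro sums_add sums_mult2 pmf_poisson_ln_fact_sums pmf_poisson_sums_1 pmf_poisson_mean_sums)
    also have "(\<lambda>k. pmf (poisson_pmf lam) k * ln (fact k) + (pmf (poisson_pmf lam) k * (h * (ln lam + 1 / lam - 1)) +
        pmf (poisson_pmf lam) k * real k * (h / lam))) = (\<lambda>k. pmf (poisson_pmf lam) k * z k)"
      by (rule ext) (simp add: z_def algebra_simps add_divide_distrib del: pmf_poisson)
    finally show ?thesis using assms by simp
  qed
  note z_int = nn_integral_poisson0_eq_sums[OF assms(1) z0 this]
  have "ennreal (K (lam + h)) = (\<integral>\<^sup>+k. ennreal (ln (fact k)) \<partial>add_pmf (poisson0_pmf lam) (poisson0_pmf h))"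
    using assms unfolding K_def by (subst add_pmf_poisson0) (auto simp: nn_integral_poisson0_ln_fact)
  also have "\<dots> \<le> (\<integral>\<^sup>+k. ennreal (ln (fact k)) \<partial>add_pmf (poisson0_pmf lam) (bernoulli_nat_pmf h)) +
      ennreal (h\<^sup>2 / (lam + h))"
    using assms by (intro nn_integral_ln_fact_replace_bernoulli) (auto intro: size_bias_le_poisson0)
  also have "(\<integral>\<^sup>+k. ennreal (ln (fact k)) \<partial>add_pmf (poisson0_pmf lam) (bernoulli_nat_pmf h)) \<le>
      (\<integral>\<^sup>+k. ennreal (z k) \<partial>poisson0_pmf lam)"
    unfolding nn_integral_ln_fact_add_bernoulli[OF assms(2,3)]
    by (intro nn_integral_mono ennreal_leI z_ge)
  finally have le: "ennreal (K (lam + h)) \<le> ennreal (K lam + (h * (ln lam + 1 / lam - 1) + h)) + ennreal (h\<^sup>2 / (lam + h))"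
    unfolding z_int by simp
  \<comment> \<open>Nonnegativity permits the return from \<open>ennreal\<close>, which truncates
    negative reals to 0.\<close>
  have "0 \<le> K lam + (h * (ln lam + 1 / lam - 1) + h)"
    using sums_le[OF _ sums_zero \<open>(\<lambda>k. pmf (poisson_pmf lam) k * z k) sums _\<close>] z0 by simp
  with le have "K (lam + h) \<le> K lam + (h * (ln lam + 1 / lam - 1) + h) + h\<^sup>2 / (lam + h)"
    using assms by (subst (asm) ennreal_plus[symmetric]) (auto simp del: ennreal_plus)
  moreover have "h\<^sup>2 / (lam + h) \<le> h / lam"
    using assms by (intro frac_le) (auto simp: power2_eq_square mult_left_le)
  moreover have "(lam + h) * ln (lam + h) \<ge> (lam + h) * ln lam + h"
  proof -
    have "ln (lam / (lam + h)) \<le> lam / (lam + h) - 1"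
      using assms by (intro ln_le_minus_one) auto
    then have "(lam + h) * ln (lam / (lam + h)) \<le> (lam + h) * (lam / (lam + h) - 1)"
      using assms by (intro mult_left_mono) auto
    also have "\<dots> = - h" using assms by (simp add: right_diff_distrib)
    finally show ?thesis using assms by (simp add: ln_div right_diff_distrib)
  qed
  moreover have "h * (ln lam + 1 / lam - 1) = h * ln lam + h / lam - h"
    "(lam + h) * ln lam = lam * ln lam + h * ln lam" "2 * h / lam = h / lam + h / lam"
    by (simp_all add: algebra_simps)
  ultimately show ?thesis unfolding K_def by linarith
qed

lemma shannon_entropy_poisson_add_sum_le:
  assumes "finite A" "\<And>j. j \<in> A \<Longrightarrow> 0 \<le> p j \<and> p j \<le> 1" "0 < lam"
  shows "shannon_entropy (poisson_pmf (lam + (\<Sum>j\<in>A. p j))) \<le>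
    shannon_entropy (poisson_pmf lam) + 2 * (\<Sum>j\<in>A. p j) / lam"
  using assms(1,2)
proof (induction A)
  case (insert j A)
  let ?s = "\<Sum>i\<in>A. p i"
  have s: "0 \<le> ?s" using insert.prems by (intro sum_nonneg) auto
  have pj: "0 \<le> p j" "p j \<le> 1" using insert.prems by auto
  have "shannon_entropy (poisson_pmf (lam + ?s + p j)) \<le> shannon_entropy (poisson_pmf (lam + ?s)) + 2 * p j / (lam + ?s)"
    using pj s assms by (intro shannon_entropy_poisson_increment) auto
  also have "2 * p j / (lam + ?s) \<le> 2 * p j / lam"
    using pj s assms by (intro divide_left_mono) auto
  also have "shannon_entropy (poisson_pmf (lam + ?s)) \<le> shannon_entropy (poisson_pmf lam) + 2 * ?s / lam"
    using insert by auto
  finally show ?case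
    using insert.hyps by (simp add: add_divide_distrib distrib_left add_ac)
qed simp

section \<open>Monotonicity of entropy under independent summands\<close>

text \<open>Average the tangent inequality at the mean \<open>m\<close> over the two points.
  Boundary points are included through \<open>0 * ln 0 = 0\<close>.\<close>

lemma x_ln_x_convex:
  fixes a x y :: real
  assumes "0 \<le> a" "a \<le> 1" "0 \<le> x" "0 \<le> y"
  shows "((1 - a) * x + a * y) * ln ((1 - a) * x + a * y) \<le> (1 - a) * (x * ln x) + a * (y * ln y)"
proof -
  define m where "m = (1 - a) * x + a * y"
  have nn: "0 \<le> (1 - a) * x" "0 \<le> a * y" using assms by auto
  show ?thesis
  proof (cases "m = 0")
    case True
    then have "(1 - a) * x = 0" "a * y = 0" using nn unfolding m_def by linarith+
    then show ?thesis by auto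
  next
    case False
    then have m: "0 < m" using nn by (simp add: m_def)
    have tangent: "z * ln m + z - m \<le> z * ln z" if "0 \<le> z" for z
    proof (cases "z = 0")
      case False
      then have z: "0 < z" using that by simp
      have "z * ln (m / z) \<le> z * (m / z - 1)"
        using z m by (intro mult_left_mono ln_le_minus_one) auto
      then show ?thesis using z m by (simp add: ln_div algebra_simps)
    qed (use m in simp)
    have "(1 - a) * (x * ln m + x - m) + a * (y * ln m + y - m) \<le> (1 - a) * (x * ln x) + a * (y * ln y)"
      using assms by (intro add_mono mult_left_mono tangent) auto
    moreover have "(1 - a) * (x * ln m + x - m) + a * (y * ln m + y - m) = m * ln m"
    proof -
      have "(1 - a) * (x * ln m + x - m) + a * (y * ln m + y - m) =
          ((1 - a) * x + a * y) * ln m + ((1 - a) * x + a * y) - m"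
        by (simp add: algebra_simps)
      then show ?thesis by (simp add: m_def[symmetric])
    qed
    ultimately show ?thesis by (simp add: m_def)
  qed
qed

text \<open>Adding one variable mixes the law with its translate by one. Both have the same entropy,
  so convexity of \<open>x * ln x\<close> gives the claim.\<close>

lemma neg_entropy_bernoulli_poly_antimono:
  assumes "finite J" "finite A" "A \<inter> J = {}" "\<And>j. j \<in> A \<union> J \<Longrightarrow> 0 \<le> p j \<and> p j \<le> 1" "card (A \<union> J) \<le> N"
  shows "(\<Sum>k\<le>N. coeff (bernoulli_poly p (A \<union> J)) k * ln (coeff (bernoulli_poly p (A \<union> J)) k)) \<le>
    (\<Sum>k\<le>N. coeff (bernoulli_poly p J) k * ln (coeff (bernoulli_poly p J) k))"
  using assms(2-)
proof (induction A)
  case (insert j A)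
  define w where "w = coeff (bernoulli_poly p (A \<union> J))"
  have j: "j \<notin> A \<union> J" "finite (A \<union> J)" using insert assms by auto
  have pj: "0 \<le> p j" "p j \<le> 1" using insert.prems by auto
  have w0: "0 \<le> w k" for k
    unfolding w_def using j insert.prems by (intro coeff_bernoulli_poly_nonneg) auto
  have cN: "card (A \<union> J) < N" using j insert.prems by simp
  then have wN: "w N = 0" unfolding w_def using j by (intro coeff_bernoulli_poly_eq_0) auto
  have "(\<Sum>k\<le>N. coeff (bernoulli_poly p (insert j A \<union> J)) k * ln (coeff (bernoulli_poly p (insert j A \<union> J)) k))
    \<le> (\<Sum>k\<le>N. (1 - p j) * (w k * ln (w k)) + p j * (if k = 0 then 0 else w (k - 1) * ln (w (k - 1))))"
  proof (rule sum_mono)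
    fix k
    have "coeff (bernoulli_poly p (insert j A \<union> J)) k = (1 - p j) * w k + p j * (if k = 0 then 0 else w (k - 1))"
      using coeff_bernoulli_poly_insert[OF j(2,1), of p k] by (simp add: w_def)
    then show "coeff (bernoulli_poly p (insert j A \<union> J)) k * ln (coeff (bernoulli_poly p (insert j A \<union> J)) k)
      \<le> (1 - p j) * (w k * ln (w k)) + p j * (if k = 0 then 0 else w (k - 1) * ln (w (k - 1)))"
      using x_ln_x_convex[OF pj w0, of "if k = 0 then 0 else w (k - 1)" k] w0 by (auto split: if_splits)
  qed
  also have "\<dots> = (\<Sum>k\<le>N. w k * ln (w k))"
    using sum_shift_down[of "\<lambda>k. w k * ln (w k)" N] wN
    by (simp only: sum.distrib sum_distrib_left[symmetric]) (simp add: algebra_simps)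
  also have "\<dots> \<le> (\<Sum>k\<le>N. coeff (bernoulli_poly p J) k * ln (coeff (bernoulli_poly p J) k))"
    unfolding w_def using insert cN by (intro insert.IH) auto
  finally show ?case .
qed simp

lemma pmf_bernoulli_sum_eq_coeff:
  assumes "\<And>j. j \<in> {1..n} \<Longrightarrow> 0 \<le> p j \<and> p j \<le> 1"
  shows "pmf (bernoulli_sum_pmf n p) k = coeff (bernoulli_poly p {1..n}) k"
  using assms
proof (induction n arbitrary: k)
  case 0
  then show ?case by (simp add: bernoulli_sum_pmf_0 coeff_1 pmf_return)
next
  case (Suc n)
  have "{1..Suc n} = insert (Suc n) {1..n}" by auto
  then show ?case
    using Suc.prems[of "Suc n"] Suc.IH Suc.prems
    by (simp add: pmf_bernoulli_sum_Suc coeff_bernoulli_poly_insert)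
qed

text \<open>A zero probability contributes the factor 1. Two functions \<open>p\<close> and
  \<open>q\<close> are allowed so that truncated probabilities can be compared with the original
  ones.\<close>

lemma bernoulli_poly_drop_zeros:
  assumes "finite I" "J \<subseteq> I" "\<And>j. j \<in> J \<Longrightarrow> p j = q j" "\<And>j. j \<in> I - J \<Longrightarrow> p j = 0"
  shows "bernoulli_poly p I = bernoulli_poly q J"
proof -
  have "bernoulli_poly p I = (\<Prod>j\<in>J. [:1 - p j, p j:])"
    unfolding bernoulli_poly_def using assms by (intro prod.mono_neutral_right) (auto simp flip: one_pCons)
  then show ?thesis unfolding bernoulli_poly_def using assms by simp
qed

lemma shannon_entropy_bernoulli_sum:
  assumes "\<And>j. j \<in> {1..n} \<Longrightarrow> 0 \<le> p j \<and> p j \<le> 1"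
    and "finite J" "bernoulli_poly p {1..n} = bernoulli_poly q J" "card J \<le> N"
  shows "shannon_entropy (bernoulli_sum_pmf n p) =
    - (\<Sum>k\<le>N. coeff (bernoulli_poly q J) k * ln (coeff (bernoulli_poly q J) k))"
proof -
  have "pmf (bernoulli_sum_pmf n p) k = coeff (bernoulli_poly q J) k" for k
    using pmf_bernoulli_sum_eq_coeff[OF assms(1)] assms(3) by simp
  then show ?thesis
    unfolding shannon_entropy_def
    using assms(2,4) by (subst suminf_finite[of "{..N}"]) (auto simp: coeff_bernoulli_poly_eq_0)
qed

lemma nn_integral_bernoulli_sum:
  assumes "\<And>j. j \<in> {1..n} \<Longrightarrow> 0 \<le> p j \<and> p j \<le> 1" "\<And>k. 0 \<le> f k"
    and "finite J" "bernoulli_poly p {1..n} = bernoulli_poly q J" "card J \<le> N"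
  shows "(\<integral>\<^sup>+k. ennreal (f k) \<partial>bernoulli_sum_pmf n p) = ennreal (\<Sum>k\<le>N. coeff (bernoulli_poly q J) k * f k)"
proof -
  have w: "pmf (bernoulli_sum_pmf n p) k = coeff (bernoulli_poly q J) k" for k
    using pmf_bernoulli_sum_eq_coeff[OF assms(1)] assms(4) by simp
  have "(\<integral>\<^sup>+k. ennreal (f k) \<partial>bernoulli_sum_pmf n p) =
      (\<Sum>k\<le>N. ennreal (f k) * ennreal (pmf (bernoulli_sum_pmf n p) k))"
    using assms(3,5) by (intro nn_integral_measure_pmf_support) (auto simp: set_pmf_iff w coeff_bernoulli_poly_eq_0)
  also have "\<dots> = (\<Sum>k\<le>N. ennreal (pmf (bernoulli_sum_pmf n p) k * f k))"
    using assms(2) by (intro sum.cong) (auto simp: ennreal_mult'' mult.commute)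
  also have "\<dots> = ennreal (\<Sum>k\<le>N. pmf (bernoulli_sum_pmf n p) k * f k)"
    using assms(2) by (intro sum_ennreal) auto
  finally show ?thesis by (simp add: w)
qed

section \<open>Bounds for the entropy gap\<close>

text \<open>The constant is 3 + 1: the relative entropy contributes 3 and the expected log-factorial
  contributes 1.\<close>

lemma entropy_gap_small_probabilities:
  assumes p: "\<And>j. j \<in> {1..n} \<Longrightarrow> 0 \<le> p j \<and> p j \<le> 3 / 4"
    and lam: "(\<Sum>j=1..n. p j) = lam" "0 < lam"
  shows "shannon_entropy (poisson_pmf lam) - shannon_entropy (bernoulli_sum_pmf n p)
    \<le> 4 * (\<Sum>j=1..n. (p j)\<^sup>2) / lam"
proof -
  define I where "I = {j \<in> {1..n}. 0 < p j}"
  define w where "w = coeff (bernoulli_poly p I)"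
  define G where "G = (\<Sum>k\<le>card I. w k * ln (fact k))"
  define l2 where "l2 = (\<Sum>j=1..n. (p j)\<^sup>2)"
  have p1: "0 \<le> p j \<and> p j \<le> 1" if "j \<in> {1..n}" for j using p[OF that] by auto
  have I: "finite I" "I \<subseteq> {1..n}" "\<And>j. j \<in> {1..n} - I \<Longrightarrow> p j = 0"
    using p by (force simp: I_def)+
  have P: "bernoulli_poly p {1..n} = bernoulli_poly p I"
    using I by (intro bernoulli_poly_drop_zeros) auto
  have lamI: "lam = (\<Sum>j\<in>I. p j)"
    unfolding lam(1)[symmetric] using I by (intro sum.mono_neutral_right) auto
  have l20: "0 \<le> l2" unfolding l2_def by (intro sum_nonneg) auto
  have w0: "0 \<le> w k" for k
    unfolding w_def using I p1 by (intro coeff_bernoulli_poly_nonneg) auto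
  have HB: "shannon_entropy (bernoulli_sum_pmf n p) = - (\<Sum>k\<le>card I. w k * ln (w k))"
    unfolding w_def using p1 P I by (intro shannon_entropy_bernoulli_sum) auto
  have "(\<Sum>k\<le>card I. w k * ln (w k)) + G + lam - lam * ln lam \<le> (\<Sum>j\<in>I. (p j) ^ 3 / (1 - p j)) / lam"
    unfolding w_def G_def
  proof (rule entropy_deficit_bernoulli_poly_le)
    show "I \<noteq> {}" using lamI lam(2) by auto
    show "0 < p j \<and> p j < 1" if "j \<in> I" for j
      using p[of j] that by (auto simp: I_def)
  qed (use I lamI in auto)
  also have "\<dots> \<le> 3 * l2 / lam"
  proof (rule divide_right_mono)
    have "(\<Sum>j\<in>I. (p j) ^ 3 / (1 - p j)) \<le> (\<Sum>j\<in>I. 3 * (p j)\<^sup>2)"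
    proof (rule sum_mono)
      fix j assume "j \<in> I"
      then have pj: "0 \<le> p j" "p j \<le> 3 / 4" using p by (auto simp: I_def)
      \<comment> \<open>The threshold \<open>3 / 4\<close> is the solution of
        \<open>p = 3 * (1 - p)\<close>.\<close>
      have "(p j)\<^sup>2 * p j \<le> (p j)\<^sup>2 * (3 * (1 - p j))" using pj by (intro mult_left_mono) auto
      then show "(p j) ^ 3 / (1 - p j) \<le> 3 * (p j)\<^sup>2"
        using pj by (simp add: pos_divide_le_eq power2_eq_square power3_eq_cube mult_ac)
    qed
    also have "\<dots> = 3 * l2" unfolding l2_def sum_distrib_left
      using I by (intro sum.mono_neutral_left) auto
    finally show "(\<Sum>j\<in>I. (p j) ^ 3 / (1 - p j)) \<le> 3 * l2" .
  qed (use lam in simp)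
  finally have D: "(\<Sum>k\<le>card I. w k * ln (w k)) + G + lam - lam * ln lam \<le> 3 * l2 / lam" .
  have lf: "0 \<le> ln (fact k :: real)" for k by (simp add: fact_ge_1)
  have G0: "0 \<le> G" unfolding G_def using w0 lf by (intro sum_nonneg mult_nonneg_nonneg) auto
  have "(\<integral>\<^sup>+x. ennreal (ln (fact x)) \<partial>add_pmf (return_pmf 0) (poisson0_pmf (\<Sum>j=1..n. p j))) \<le>
    (\<integral>\<^sup>+x. ennreal (ln (fact x)) \<partial>add_pmf (return_pmf 0) (bernoulli_sum_pmf n p)) + ennreal (l2 / lam)"
    unfolding l2_def using p1 lam size_bias_le_return
    by (intro nn_integral_ln_fact_poisson0_le_bernoulli_sum[where \<mu> = 0]) auto
  then have "ennreal (shannon_entropy (poisson_pmf lam) - lam + lam * ln lam) \<le> ennreal G + ennreal (l2 / lam)"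
    unfolding G_def w_def add_pmf_return_0 lam(1) nn_integral_poisson0_ln_fact[OF lam(2)]
    using nn_integral_bernoulli_sum[OF p1 lf I(1) P order_refl] by simp
  then have "shannon_entropy (poisson_pmf lam) - lam + lam * ln lam \<le> G + l2 / lam"
    using G0 l20 lam by (subst (asm) ennreal_plus[symmetric]) (auto simp del: ennreal_plus)
  with D have "shannon_entropy (poisson_pmf lam) - shannon_entropy (bernoulli_sum_pmf n p) \<le> 3 * l2 / lam + l2 / lam"
    unfolding HB by linarith
  then show ?thesis by (simp add: l2_def add_divide_distrib[symmetric])
qed

text \<open>Dropping the probabilities above \<open>3 / 4\<close> removes mass \<open>d\<close> but
  leaves \<open>mu \<ge> lam / 3\<close>. The constant is \<open>20 = 3 * (4 + 8 / 3)\<close>: 4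
  from the small probabilities, \<open>8 / 3\<close> from the change of the Poisson rate, and 3 from
  passing from \<open>mu\<close> to \<open>lam\<close>.\<close>

lemma entropy_gap_le:
  assumes p: "\<And>j. j \<in> {1..n} \<Longrightarrow> 0 \<le> p j \<and> p j \<le> 1"
    and lam: "(\<Sum>j=1..n. p j) = lam" "0 < lam" and l2: "(\<Sum>j=1..n. (p j)\<^sup>2) \<le> lam / 2"
  shows "shannon_entropy (poisson_pmf lam) - shannon_entropy (bernoulli_sum_pmf n p)
    \<le> 20 * (\<Sum>j=1..n. (p j)\<^sup>2) / lam"
proof -
  define J where "J = {j \<in> {1..n}. p j \<le> 3 / 4}"
  define A where "A = {1..n} - J"
  define r where "r j = (if p j \<le> 3 / 4 then p j else 0)" for j
  define l2 where "l2 = (\<Sum>j=1..n. (p j)\<^sup>2)"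
  define mu where "mu = (\<Sum>j=1..n. r j)"
  define d where "d = (\<Sum>j\<in>A. p j)"
  have AJ: "A \<union> J = {1..n}" "A \<inter> J = {}" "finite A" "finite J" by (auto simp: A_def J_def)
  have r: "0 \<le> r j \<and> r j \<le> 3 / 4" if "j \<in> {1..n}" for j using p[OF that] by (auto simp: r_def)
  have r1: "0 \<le> r j \<and> r j \<le> 1" if "j \<in> {1..n}" for j using r[OF that] by auto
  have muJ: "mu = (\<Sum>j\<in>J. p j)"
    unfolding mu_def r_def J_def by (rule sum.inter_filter[symmetric]) simp
  have lam_eq: "lam = mu + d"
    unfolding muJ d_def lam(1)[symmetric] AJ(1)[symmetric] using AJ
    by (subst sum.union_disjoint) auto
  have l20: "0 \<le> l2" unfolding l2_def by (intro sum_nonneg) auto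
  have d: "d \<le> 4 / 3 * l2"
  proof -
    have "p j \<le> 4 / 3 * (p j)\<^sup>2" if "j \<in> A" for j
    proof -
      have "p j * (3 / 4) \<le> p j * p j" using that by (intro mult_left_mono) (auto simp: A_def J_def)
      then show ?thesis by (simp add: power2_eq_square)
    qed
    then have "d \<le> (\<Sum>j\<in>A. 4 / 3 * (p j)\<^sup>2)" unfolding d_def by (intro sum_mono) auto
    also have "\<dots> \<le> (\<Sum>j=1..n. 4 / 3 * (p j)\<^sup>2)" by (intro sum_mono2) (auto simp: A_def)
    finally show ?thesis by (simp add: l2_def sum_distrib_left)
  qed
  \<comment> \<open>Indeed \<open>d \<le> 4 / 3 * l2 \<le> 2 / 3 * lam\<close>.\<close>
  have mu: "lam / 3 \<le> mu" using d l2 lam_eq by (simp add: l2_def)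
  then have mu0: "0 < mu" using lam by linarith
  have P: "bernoulli_poly r {1..n} = bernoulli_poly p J"
    by (intro bernoulli_poly_drop_zeros) (auto simp: r_def J_def)
  have "card J \<le> card {1..n}" by (rule card_mono) (auto simp: J_def)
  then have cJ: "card J \<le> n" by simp
  have "shannon_entropy (bernoulli_sum_pmf n r) =
      - (\<Sum>k\<le>n. coeff (bernoulli_poly p J) k * ln (coeff (bernoulli_poly p J) k))"
    using r1 AJ P cJ by (intro shannon_entropy_bernoulli_sum) auto
  moreover have "shannon_entropy (bernoulli_sum_pmf n p) =
      - (\<Sum>k\<le>n. coeff (bernoulli_poly p (A \<union> J)) k * ln (coeff (bernoulli_poly p (A \<union> J)) k))"
    using p AJ by (intro shannon_entropy_bernoulli_sum) auto
  moreover have "(\<Sum>k\<le>n. coeff (bernoulli_poly p (A \<union> J)) k * ln (coeff (bernoulli_poly p (A \<union> J)) k)) \<le>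
    (\<Sum>k\<le>n. coeff (bernoulli_poly p J) k * ln (coeff (bernoulli_poly p J) k))"
    using AJ p by (intro neg_entropy_bernoulli_poly_antimono) auto
  ultimately have 1: "shannon_entropy (bernoulli_sum_pmf n r) \<le> shannon_entropy (bernoulli_sum_pmf n p)"
    by linarith
  have 2: "shannon_entropy (poisson_pmf lam) \<le> shannon_entropy (poisson_pmf mu) + 2 * d / mu"
    unfolding lam_eq d_def using p mu0
    by (intro shannon_entropy_poisson_add_sum_le) (auto simp: A_def)
  have 3: "shannon_entropy (poisson_pmf mu) - shannon_entropy (bernoulli_sum_pmf n r)
      \<le> 4 * (\<Sum>j=1..n. (r j)\<^sup>2) / mu"
    using r mu0 by (intro entropy_gap_small_probabilities) (auto simp: mu_def)
  have "(\<Sum>j=1..n. (r j)\<^sup>2) \<le> l2" unfolding l2_def by (intro sum_mono) (auto simp: r_def)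
  then have "4 * (\<Sum>j=1..n. (r j)\<^sup>2) / mu + 2 * d / mu \<le> 4 * l2 / mu + 2 * (4 / 3 * l2) / mu"
    using d mu0 by (intro add_mono divide_right_mono) auto
  also have "\<dots> = (20 / 3 * l2) / mu" by (simp add: add_divide_distrib[symmetric])
  also have "\<dots> \<le> (20 / 3 * l2) / (lam / 3)"
    using mu mu0 lam l20 by (intro divide_left_mono) auto
  finally show ?thesis using 1 2 3 unfolding l2_def by simp
qed

lemma shannon_entropy_bernoulli_sum_nonneg: "0 \<le> shannon_entropy (bernoulli_sum_pmf n p)"
proof -
  have "(\<Sum>k. pmf (bernoulli_sum_pmf n p) k * ln (pmf (bernoulli_sum_pmf n p) k)) \<le> (\<Sum>k::nat. 0)"
  proof (rule suminf_le)
    fix k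
    show "pmf (bernoulli_sum_pmf n p) k * ln (pmf (bernoulli_sum_pmf n p) k) \<le> 0"
      using pmf_le_1[of "bernoulli_sum_pmf n p" k] pmf_nonneg[of "bernoulli_sum_pmf n p" k]
      by (cases "pmf (bernoulli_sum_pmf n p) k = 0") (auto intro!: mult_nonneg_nonpos ln_le_zero_iff[THEN iffD2])
  qed (auto intro: summable_entropy_bernoulli_sum)
  then show ?thesis by (simp add: shannon_entropy_def)
qed

theorem corollary1p3:
  shows "(\<forall>lam::real. lam > 0 \<longrightarrow>
           (\<exists>C::real. \<forall>(n::nat) (p::nat \<Rightarrow> real).
              n \<ge> 1 \<longrightarrow> (\<forall>j\<in>{1..n}. 0 \<le> p j \<and> p j \<le> 1) \<longrightarrow> (\<Sum>j=1..n. p j) = lam \<longrightarrow>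
              shannon_entropy (poisson_pmf lam) - shannon_entropy (bernoulli_sum_pmf n p)
                \<le> C * ((\<Sum>j=1..n. (p j)\<^sup>2) / lam)))
       \<and> (\<exists>C::real. \<forall>(lam::real) (n::nat) (p::nat \<Rightarrow> real).
              lam > 0 \<longrightarrow> n \<ge> 1 \<longrightarrow> (\<forall>j\<in>{1..n}. 0 \<le> p j \<and> p j \<le> 1) \<longrightarrow> (\<Sum>j=1..n. p j) = lam \<longrightarrow>
              (\<Sum>j=1..n. (p j)\<^sup>2) \<le> lam / 2 \<longrightarrow>
              shannon_entropy (poisson_pmf lam) - shannon_entropy (bernoulli_sum_pmf n p)
                \<le> C * ln (2 + lam) * ((\<Sum>j=1..n. (p j)\<^sup>2) / lam))"
proof (intro conjI allI impI)
  fix lam :: real assume lam: "lam > 0"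
  let ?H = "shannon_entropy (poisson_pmf lam)"
  show "\<exists>C::real. \<forall>(n::nat) (p::nat \<Rightarrow> real).
              n \<ge> 1 \<longrightarrow> (\<forall>j\<in>{1..n}. 0 \<le> p j \<and> p j \<le> 1) \<longrightarrow> (\<Sum>j=1..n. p j) = lam \<longrightarrow>
              ?H - shannon_entropy (bernoulli_sum_pmf n p) \<le> C * ((\<Sum>j=1..n. (p j)\<^sup>2) / lam)"
  \<comment> \<open>The 20 serves the case \<open>l2 \<le> lam / 2\<close>. In the other case the
    ratio exceeds \<open>1 / 2\<close>, so the second summand already dominates the Poisson
    entropy.\<close>
  proof (intro exI[of _ "20 + 2 * \<bar>?H\<bar>"] allI impI)
    fix n and p :: "nat \<Rightarrow> real"
    assume p: "\<forall>j\<in>{1..n}. 0 \<le> p j \<and> p j \<le> 1" and s: "(\<Sum>j=1..n. p j) = lam"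
    define x where "x = (\<Sum>j=1..n. (p j)\<^sup>2) / lam"
    have x0: "0 \<le> x" unfolding x_def using lam by (intro divide_nonneg_pos sum_nonneg) auto
    show "?H - shannon_entropy (bernoulli_sum_pmf n p) \<le> (20 + 2 * \<bar>?H\<bar>) * ((\<Sum>j=1..n. (p j)\<^sup>2) / lam)"
    proof (cases "(\<Sum>j=1..n. (p j)\<^sup>2) \<le> lam / 2")
      case True
      have "?H - shannon_entropy (bernoulli_sum_pmf n p) \<le> 20 * x"
        using entropy_gap_le[of n p lam] p s lam True by (simp add: x_def)
      also have "\<dots> \<le> (20 + 2 * \<bar>?H\<bar>) * x" using x0 by (intro mult_right_mono) auto
      finally show ?thesis by (simp add: x_def)
    next
      case False
      then have "1 / 2 \<le> x" using lam by (simp add: x_def field_simps)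
      then have "2 * \<bar>?H\<bar> * (1 / 2) \<le> 2 * \<bar>?H\<bar> * x" by (intro mult_left_mono) auto
      then have "?H \<le> 20 * x + 2 * \<bar>?H\<bar> * x" using x0 by linarith
      then show ?thesis
        unfolding x_def[symmetric] distrib_right
        using shannon_entropy_bernoulli_sum_nonneg[of n p] by linarith
    qed
  qed
next
  show "\<exists>C::real. \<forall>(lam::real) (n::nat) (p::nat \<Rightarrow> real).
              lam > 0 \<longrightarrow> n \<ge> 1 \<longrightarrow> (\<forall>j\<in>{1..n}. 0 \<le> p j \<and> p j \<le> 1) \<longrightarrow> (\<Sum>j=1..n. p j) = lam \<longrightarrow>
              (\<Sum>j=1..n. (p j)\<^sup>2) \<le> lam / 2 \<longrightarrow>
              shannon_entropy (poisson_pmf lam) - shannon_entropy (bernoulli_sum_pmf n p)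
                \<le> C * ln (2 + lam) * ((\<Sum>j=1..n. (p j)\<^sup>2) / lam)"
  \<comment> \<open>Dividing by \<open>ln 2\<close> compensates for the smallest possible size of
    \<open>ln (2 + lam)\<close>.\<close>
  proof (intro exI[of _ "20 / ln 2"] allI impI)
    fix lam :: real and n and p :: "nat \<Rightarrow> real"
    assume lam: "0 < lam" and p: "\<forall>j\<in>{1..n}. 0 \<le> p j \<and> p j \<le> 1" and s: "(\<Sum>j=1..n. p j) = lam"
      and l2: "(\<Sum>j=1..n. (p j)\<^sup>2) \<le> lam / 2"
    have "20 \<le> 20 / ln 2 * ln (2 + lam)"
    proof -
      have "ln 2 \<le> ln (2 + lam)" using lam by simp
      then show ?thesis by (simp add: field_simps)
    qed
    then have "20 * ((\<Sum>j=1..n. (p j)\<^sup>2) / lam) \<le> 20 / ln 2 * ln (2 + lam) * ((\<Sum>j=1..n. (p j)\<^sup>2) / lam)"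
      using lam by (intro mult_right_mono divide_nonneg_pos sum_nonneg) auto
    then show "shannon_entropy (poisson_pmf lam) - shannon_entropy (bernoulli_sum_pmf n p)
                \<le> 20 / ln 2 * ln (2 + lam) * ((\<Sum>j=1..n. (p j)\<^sup>2) / lam)"
      using entropy_gap_le[of n p lam] p s lam l2 by simp
  qed
qed

end
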